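(* Consider a linear quadratic problem with data $(A,B,H)$ for which quadratic strict $(x,u)$-pre-dissipativity holds, with $(A,B)$ controllable, and let $\bar P_{\mathrm s}$ be the stabilizing solution of the RDARE (which exists under these hypotheses). Choose the terminal cost matrix $P^{\mathrm f}=\bar P_{\mathrm s}+E$ with $E$ symmetric, $E\succ0$. Then the optimal solution of the infinite-horizon LQR problem with terminal cost matrix $P^{\mathrm f}$ is given by the unique stabilizing solution $P_{\mathrm s}$ (with gain $K_{\mathrm s}$) of the DARE, i.e. the optimal value function is $V(x)=x^\top P_{\mathrm s}x$ and the optimal feedback is $u=-K_{\mathrm s}x$. In particular, the origin is an asymptotically stable equilibrium of the optimally controlled system.
   Context: Data: real matrices $A\in\mathbb R^{n_x\times n_x}$, $B\in\mathbb R^{n_x\times n_u}$, and a symmetric (possibly indefinite) matrix $H=\begin{bmatrix}Q&S^\top\\ S&R\end{bmatrix}$. Stage cost: $\ell(x,u)=\begin{bmatrix}x\\ u\end{bmatrix}^\top H\begin{bmatrix}x\\ u\end{bmatrix}$. For symmetric $\Lambda$ the rotated cost matrix is $H_\Lambda=\begin{bmatrix}Q+\Lambda-A^\top\Lambda A & S^\top-A^\top\Lambda B\\ S-B^\top\Lambda A& R-B^\top\Lambda B\end{bmatrix}$. Quadratic strict $(x,u)$-pre-dissipativity holds if there is a symmetric $\Lambda$ with $H_\Lambda\succ0$. Infinite-horizon LQR problem with terminal cost matrix $P^{\mathrm f}$: $V(x_0)=\min_{u_0,u_1,\dots}\lim_{N\to\infty}\sum_{k=0}^{N-1}\ell(x_k,u_k)+x_N^\top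 P^{\mathrm f}x_N$ subject to $x_{k+1}=Ax_k+Bu_k$ (over input sequences for which the limit exists in the extended reals). DARE: $P=Q+A^\top PA-(S^\top+A^\top PB)K$, $K=(R+B^\top PB)^{-1}(S+B^\top PA)$; only symmetric solutions are considered. The stabilizing solution $P_{\mathrm s}$, with gain $K_{\mathrm s}$, is the (unique, if it exists) one for which all eigenvalues of $A-BK_{\mathrm s}$ lie strictly inside the unit circle. RDARE (reverse discrete-time algebraic Riccati equation), for $A$ nonsingular: $\bar P=\bar Q+\bar A^\top\bar P\bar A-(\bar S^\top+\bar A^\top\bar P\bar B)\bar K$, $\bar K=(\bar R+\bar B^\top\bar P\bar B)^{-1}(\bar S+\bar B^\top\bar P\bar A)$, where $\bar A=A^{-1}$, $\bar B=A^{-1}B$, $\bar Q=-\bar A^\top Q\bar A$, $\bar S=S\bar A-\bar B^\top Q\bar A$, $\bar R=-R+S\bar B+\bar B^\top S^\top-\bar B^\top Q\bar B$. Its stabilizing solution $\bar P_{\mathrm s}$ is the (unique) symmetric solution for which all eigenvalues of $\bar A-\bar B\bar K$ lie strictly inside the unit circle. If $A$ is singular, the RDARE is understood as the RDARE of the pre-stabilized data, obtained by choosing $\hat K$ with $A-B\hat K$ nonsingular and replacing $A$ by $A-B\hat K$, $Q$ by $Q-S^\top\hat K-\hat K^\top S+\hat K^\top R\hat K$, $S$ by $S-R\hat K$ ($B$, $R$ unchanged). *)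

theory Defs
  imports "HOL-Analysis.Analysis"
begin

definition symmetric_matrix :: "real^'n^'n \<Rightarrow> bool"
  where "symmetric_matrix M \<longleftrightarrow> transpose M = M"

definition positive_definite :: "real^'n^'n \<Rightarrow> bool"
  where "positive_definite M \<longleftrightarrow> symmetric_matrix M \<and> (\<forall>x. x \<noteq> 0 \<longrightarrow> x \<bullet> (M *v x) > 0)"

definition stack :: "real^'n \<Rightarrow> real^'m \<Rightarrow> real^('n + 'm)"
  where "stack x u = (\<chi> i. case i of Inl a \<Rightarrow> x $ a | Inr b \<Rightarrow> u $ b)"

definition block_matrix ::
  "real^'n^'n \<Rightarrow> real^'m^'n \<Rightarrow> real^'n^'m \<Rightarrow> real^'m^'m \<Rightarrow> real^('n + 'm)^('n + 'm)"
  where "block_matrix M11 M12 M21 M22 =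
    (\<chi> i. case i of Inl a \<Rightarrow> stack (M11 $ a) (M12 $ a) | Inr b \<Rightarrow> stack (M21 $ b) (M22 $ b))"

definition complex_eigenvalue :: "real^'n^'n \<Rightarrow> complex \<Rightarrow> bool"
  where "complex_eigenvalue M z \<longleftrightarrow>
    (\<exists>v :: complex^'n. v \<noteq> 0 \<and> map_matrix complex_of_real M *v v = z *s v)"

definition schur_stable :: "real^'n^'n \<Rightarrow> bool"
  where "schur_stable M \<longleftrightarrow> (\<forall>z. complex_eigenvalue M z \<longrightarrow> cmod z < 1)"

primrec trajectory ::
  "real^'n^'n \<Rightarrow> real^'m^'n \<Rightarrow> real^'n \<Rightarrow> (nat \<Rightarrow> real^'m) \<Rightarrow> nat \<Rightarrow> real^'n"
  where
    "trajectory A B x0 u 0 = x0"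
  | "trajectory A B x0 u (Suc k) = A *v trajectory A B x0 u k + B *v u k"

text \<open>Controllability in Kalman's sense: every state can be steered to every other
  state in finitely many steps.\<close>

definition controllable :: "real^'n^'n \<Rightarrow> real^'m^'n \<Rightarrow> bool"
  where "controllable A B \<longleftrightarrow> (\<forall>x0 x1. \<exists>N u. trajectory A B x0 u N = x1)"

definition asymptotically_stable_equilibrium ::
  "('a::real_normed_vector \<Rightarrow> 'a) \<Rightarrow> 'a \<Rightarrow> bool"
  where "asymptotically_stable_equilibrium f xe \<longleftrightarrow>
    f xe = xe \<and>
    (\<forall>\<epsilon>>0. \<exists>\<delta>>0. \<forall>x0. dist x0 xe < \<delta> \<longrightarrow> (\<forall>k. dist ((f ^^ k) x0) xe < \<epsilon>)) \<and>
    (\<exists>\<delta>>0. \<forall>x0. dist x0 xe < \<delta> \<longrightarrow> (\<lambda>k. (f ^^ k) x0) \<longlonglongrightarrow> xe)"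

definition cost_matrix ::
  "real^'n^'n \<Rightarrow> real^'n^'m \<Rightarrow> real^'m^'m \<Rightarrow> real^('n + 'm)^('n + 'm)"
  where "cost_matrix Q S R = block_matrix Q (transpose S) S R"

definition stage_cost :: "real^('n + 'm)^('n + 'm) \<Rightarrow> real^'n \<Rightarrow> real^'m \<Rightarrow> real"
  where "stage_cost H x u = stack x u \<bullet> (H *v stack x u)"

definition rotated_cost_matrix ::
  "real^'n^'n \<Rightarrow> real^'m^'n \<Rightarrow> real^'n^'n \<Rightarrow> real^'n^'m \<Rightarrow> real^'m^'m \<Rightarrow> real^'n^'n
    \<Rightarrow> real^('n + 'm)^('n + 'm)"
  where "rotated_cost_matrix A B Q S R L =
    block_matrix
      (Q + L - transpose A ** L ** A) (transpose S - transpose A ** L ** B)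
      (S - transpose B ** L ** A)     (R - transpose B ** L ** B)"

definition quadratic_strict_xu_pre_dissipative ::
  "real^'n^'n \<Rightarrow> real^'m^'n \<Rightarrow> real^'n^'n \<Rightarrow> real^'n^'m \<Rightarrow> real^'m^'m \<Rightarrow> bool"
  where "quadratic_strict_xu_pre_dissipative A B Q S R \<longleftrightarrow>
    (\<exists>L. symmetric_matrix L \<and> positive_definite (rotated_cost_matrix A B Q S R L))"

definition dare_gain ::
  "real^'n^'n \<Rightarrow> real^'m^'n \<Rightarrow> real^'n^'m \<Rightarrow> real^'m^'m \<Rightarrow> real^'n^'n \<Rightarrow> real^'n^'m"
  where "dare_gain A B S R P =
    matrix_inv (R + transpose B ** P ** B) ** (S + transpose B ** P ** A)"

text \<open>\<open>matrix_inv\<close> is unspecified on singular matrices, so the inverse in the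
  gain has to be required to exist.\<close>

definition dare_solution ::
  "real^'n^'n \<Rightarrow> real^'m^'n \<Rightarrow> real^'n^'n \<Rightarrow> real^'n^'m \<Rightarrow> real^'m^'m \<Rightarrow> real^'n^'n \<Rightarrow> bool"
  where "dare_solution A B Q S R P \<longleftrightarrow>
    symmetric_matrix P \<and>
    invertible (R + transpose B ** P ** B) \<and>
    P = Q + transpose A ** P ** A
        - (transpose S + transpose A ** P ** B) ** dare_gain A B S R P"

definition dare_stabilizing_solution ::
  "real^'n^'n \<Rightarrow> real^'m^'n \<Rightarrow> real^'n^'n \<Rightarrow> real^'n^'m \<Rightarrow> real^'m^'m \<Rightarrow> real^'n^'n \<Rightarrow> bool"
  where "dare_stabilizing_solution A B Q S R P \<longleftrightarrow>
    dare_solution A B Q S R P \<and> schur_stable (A - B ** dare_gain A B S R P)"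

text \<open>The reverse equation is the DARE of the time-reversed data; meaningful for
  nonsingular \<open>A\<close> only.\<close>

definition rdare_stabilizing_solution_nonsingular ::
  "real^'n^'n \<Rightarrow> real^'m^'n \<Rightarrow> real^'n^'n \<Rightarrow> real^'n^'m \<Rightarrow> real^'m^'m \<Rightarrow> real^'n^'n \<Rightarrow> bool"
  where "rdare_stabilizing_solution_nonsingular A B Q S R P \<longleftrightarrow>
    (let A' = matrix_inv A;
         B' = matrix_inv A ** B;
         Q' = - (transpose A' ** Q ** A');
         S' = S ** A' - transpose B' ** Q ** A';
         R' = - R + S ** B' + transpose B' ** transpose S - transpose B' ** Q ** B'
     in dare_stabilizing_solution A' B' Q' S' R' P)"

text \<open>For nonsingular \<open>A\<close> no pre-stabilization takes place, which is encoded by the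
  zero feedback.\<close>

definition pre_stabilizing_gain :: "real^'n^'n \<Rightarrow> real^'m^'n \<Rightarrow> real^'n^'m \<Rightarrow> bool"
  where "pre_stabilizing_gain A B K \<longleftrightarrow>
    (if invertible A then K = 0 else invertible (A - B ** K))"

definition rdare_stabilizing_solution ::
  "real^'n^'n \<Rightarrow> real^'m^'n \<Rightarrow> real^'n^'n \<Rightarrow> real^'n^'m \<Rightarrow> real^'m^'m \<Rightarrow> real^'n^'m
    \<Rightarrow> real^'n^'n \<Rightarrow> bool"
  where "rdare_stabilizing_solution A B Q S R K P \<longleftrightarrow>
    rdare_stabilizing_solution_nonsingular (A - B ** K) B
      (Q - transpose S ** K - transpose K ** S + transpose K ** R ** K) (S - R ** K) R P"

definition finite_horizon_cost ::
  "real^'n^'n \<Rightarrow> real^'m^'n \<Rightarrow> real^('n + 'm)^('n + 'm) \<Rightarrow> real^'n^'n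
    \<Rightarrow> real^'n \<Rightarrow> (nat \<Rightarrow> real^'m) \<Rightarrow> nat \<Rightarrow> real"
  where "finite_horizon_cost A B H Pf x0 u N =
    (\<Sum>k<N. stage_cost H (trajectory A B x0 u k) (u k))
    + trajectory A B x0 u N \<bullet> (Pf *v trajectory A B x0 u N)"

definition lqr_has_cost ::
  "real^'n^'n \<Rightarrow> real^'m^'n \<Rightarrow> real^('n + 'm)^('n + 'm) \<Rightarrow> real^'n^'n
    \<Rightarrow> real^'n \<Rightarrow> (nat \<Rightarrow> real^'m) \<Rightarrow> ereal \<Rightarrow> bool"
  where "lqr_has_cost A B H Pf x0 u J \<longleftrightarrow>
    (\<lambda>N. ereal (finite_horizon_cost A B H Pf x0 u N)) \<longlonglongrightarrow> J"

definition lqr_value ::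
  "real^'n^'n \<Rightarrow> real^'m^'n \<Rightarrow> real^('n + 'm)^('n + 'm) \<Rightarrow> real^'n^'n \<Rightarrow> real^'n \<Rightarrow> ereal"
  where "lqr_value A B H Pf x0 = Inf {J. \<exists>u. lqr_has_cost A B H Pf x0 u J}"

definition lqr_optimal_input ::
  "real^'n^'n \<Rightarrow> real^'m^'n \<Rightarrow> real^('n + 'm)^('n + 'm) \<Rightarrow> real^'n^'n
    \<Rightarrow> real^'n \<Rightarrow> (nat \<Rightarrow> real^'m) \<Rightarrow> bool"
  where "lqr_optimal_input A B H Pf x0 u \<longleftrightarrow>
    lqr_has_cost A B H Pf x0 u (lqr_value A B H Pf x0)"

end

(*
  For a solution P of the DARE with gain K, completing the square turns the finite-horizon cost into
  x^T P x + sum_k (u_k + K x_k)^T (R + B^T P B) (u_k + K x_k) + x_N^T (Pf - P) x_N.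
  For P = Ps the sum is a sum of squares, so everything hinges on x_N -> 0 along every input of
  cost < infinity.  For P = Pbar the stage terms are still nonnegative (the RDARE is, up to
  sign, the DARE of a time-reversed minimization problem, with storage matrix -Lambda), hence
  x_N^T E x_N is bounded; with x_N bounded, strict dissipativity makes sum_k |x_k|^2 finite.

  Ps is obtained by value iteration started at -Lambda, which increases because of
  dissipativity and is bounded because of controllability.
*)

theory Submission
  imports Defs "HOL-Computational_Algebra.Fundamental_Theorem_Algebra"
begin

subsection \<open>Quadratic forms\<close>

text \<open>The stage cost is indefinite, and the square completed with \<open>Ps\<close> leaves a
  terminal term in \<open>Pf - Ps\<close> whose sign is not controlled. Hence the cost of an input
  is compared with \<open>Ps\<close> only after its trajectory is known to tend to zero, where that
  term vanishes whatever its sign. What replaces definiteness of the data is the order relation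
  \<open>P >= - L\<close> (predicate \<open>admissible\<close>): strict dissipativity makes
  \<open>R + B^T P B\<close> positive definite for every such \<open>P\<close>, so each Riccati step
  is a genuine minimization over the input. The definition of a stabilizing solution does not
  mention this relation. Uniqueness therefore does real work: it identifies any given stabilizing
  solution with the one constructed by value iteration, which satisfies it. This applies both to
  \<open>Ps\<close> and, after reversal and negation, to \<open>Pbar\<close>.\<close>

lemma matrix_vector_mult_minus_left [simp]: "(- M) *v x = - (M *v (x :: real^'n))"
  using matrix_vector_mult_diff_rdistrib[of 0 M x] by simp

lemma matrix_vector_mult_minus_right [simp]: "M *v (- x) = - (M *v (x :: real^'n))"
  using matrix_vector_mult_diff_distrib[of M 0 x] by simp

lemmas matrix_vector_expand =
  matrix_vector_mult_add_rdistrib matrix_vector_mult_diff_rdistrib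
  matrix_vector_right_distrib matrix_vector_mult_diff_distrib
  matrix_vector_mul_assoc[symmetric]

lemma inner_vector_matrix: "x \<bullet> (y v* M) = (M *v x) \<bullet> (y :: real^'n)"
  by (metis dot_lmul_matrix inner_commute)

text \<open>A normal form for Riccati identities: products become nested applications and transposes
  move across the inner product. What remains is linear in scalar atoms, up to symmetries supplied
  as explicit instances.\<close>

lemmas bilinear_expand = matrix_vector_expand dot_lmul_matrix inner_vector_matrix
  inner_add_left inner_add_right inner_diff_left inner_diff_right

lemma symmetric_matrix_iff:
  "symmetric_matrix M \<longleftrightarrow> (\<forall>x y. x \<bullet> (M *v y) = y \<bullet> (M *v x))"
proof
  assume "symmetric_matrix M"
  then show "\<forall>x y. x \<bullet> (M *v y) = y \<bullet> (M *v x)"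
    unfolding symmetric_matrix_def by (metis dot_lmul_matrix inner_commute transpose_matrix_vector)
next
  assume *: "\<forall>x y. x \<bullet> (M *v y) = y \<bullet> (M *v x)"
  have "transpose M *v y = M *v y" for y
    by (rule vector_eq_rdot[THEN iffD1]) (metis * dot_lmul_matrix inner_commute transpose_matrix_vector)
  then show "symmetric_matrix M"
    unfolding symmetric_matrix_def by (simp add: matrix_eq)
qed

lemma symmetric_matrixD: "symmetric_matrix M \<Longrightarrow> x \<bullet> (M *v y) = y \<bullet> (M *v x)"
  by (simp add: symmetric_matrix_iff)

lemma symmetric_matrix_transpose_mult [simp]:
  "symmetric_matrix P \<Longrightarrow> symmetric_matrix (transpose M ** P ** M)"
  by (simp add: symmetric_matrix_def matrix_transpose_mul matrix_mul_assoc)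

lemma symmetric_matrix_add [simp]:
  "symmetric_matrix M \<Longrightarrow> symmetric_matrix N \<Longrightarrow> symmetric_matrix (M + N)"
  by (simp add: symmetric_matrix_iff bilinear_expand)

lemma symmetric_matrix_diff [simp]:
  "symmetric_matrix M \<Longrightarrow> symmetric_matrix N \<Longrightarrow> symmetric_matrix (M - N)"
  by (simp add: symmetric_matrix_iff bilinear_expand)

lemma symmetric_matrix_minus [simp]: "symmetric_matrix (- M) \<longleftrightarrow> symmetric_matrix M"
  by (simp add: symmetric_matrix_iff)

definition quad_form :: "real^'n^'n \<Rightarrow> real^'n \<Rightarrow> real"
  where "quad_form M x = x \<bullet> (M *v x)"

lemma quad_form_zero [simp]: "quad_form M 0 = 0"
  by (simp add: quad_form_def)

lemma quad_form_minus_matrix [simp]: "quad_form (- M) x = - quad_form M x"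
  by (simp add: quad_form_def)

lemma quad_form_add_matrix: "quad_form (M + N) x = quad_form M x + quad_form N x"
  by (simp add: quad_form_def bilinear_expand)

lemma quad_form_diff_matrix: "quad_form (M - N) x = quad_form M x - quad_form N x"
  by (simp add: quad_form_def bilinear_expand)

lemma quad_form_scaleR: "quad_form M (c *\<^sub>R x) = c\<^sup>2 * quad_form M x"
  by (simp add: quad_form_def matrix_vector_mult_scaleR power2_eq_square)

lemma continuous_on_matrix_vector_mult [continuous_intros]:
  "continuous_on X f \<Longrightarrow> continuous_on X (\<lambda>x. M *v (f x :: real^'n))"
  by (rule bounded_linear.continuous_on[OF matrix_vector_mul_bounded_linear])

lemma continuous_on_quad_form [continuous_intros]:
  "continuous_on X f \<Longrightarrow> continuous_on X (\<lambda>x. quad_form M (f x))"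
  unfolding quad_form_def by (intro continuous_intros)

lemma tendsto_matrix_vector_mult:
  fixes M :: "'b \<Rightarrow> real^'k^'l"
  assumes "(M \<longlongrightarrow> M') F" "(f \<longlongrightarrow> x) F"
  shows "((\<lambda>t. M t *v f t) \<longlongrightarrow> M' *v x) F"
  unfolding matrix_vector_mult_def
  by (intro vec_tendstoI) (auto intro!: tendsto_intros assms)

lemma tendsto_quad_form:
  assumes "(M \<longlongrightarrow> M') F" "(f \<longlongrightarrow> x) F"
  shows "((\<lambda>t. quad_form (M t) (f t)) \<longlongrightarrow> quad_form M' x) F"
  unfolding quad_form_def by (intro tendsto_inner tendsto_matrix_vector_mult assms)

lemma quad_form_polarization:
  assumes "symmetric_matrix M"
  shows "x \<bullet> (M *v y) = (quad_form M (x + y) - quad_form M x - quad_form M y) / 2"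
  using symmetric_matrixD[OF assms, of x y] by (simp add: quad_form_def bilinear_expand)

text \<open>With polarization this reduces equality and convergence of symmetric matrices to their
  quadratic forms.\<close>

lemma matrix_nth_eq_inner: "M $ i $ j = axis i 1 \<bullet> (M *v axis j (1::real))"
  by (simp add: inner_axis' matrix_vector_mul_component inner_axis)

lemma symmetric_matrix_eqI:
  assumes "symmetric_matrix M" "symmetric_matrix N" "\<And>x. quad_form M x = quad_form N x"
  shows "M = N"
  using assms(3) by (simp add: vec_eq_iff matrix_nth_eq_inner
      quad_form_polarization[OF assms(1)] quad_form_polarization[OF assms(2)])

section \<open>Two-sided bounds by the squared norm\<close>

lemma quad_form_upper_bound:
  fixes M :: "real^'n^'n"
  obtains C where "C \<ge> 0" "\<And>x. quad_form M x \<le> C * (norm x)\<^sup>2"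
proof -
  obtain C where C: "C > 0" "\<And>x. norm (M *v x) \<le> norm x * C"
    using bounded_linear.pos_bounded[OF matrix_vector_mul_bounded_linear, of M] by auto
  have "quad_form M x \<le> C * (norm x)\<^sup>2" for x
  proof -
    have "quad_form M x \<le> norm x * norm (M *v x)"
      unfolding quad_form_def by (rule norm_cauchy_schwarz)
    also have "\<dots> \<le> norm x * (norm x * C)"
      by (intro mult_left_mono C) simp
    finally show ?thesis by (simp add: power2_eq_square mult_ac)
  qed
  with C show ?thesis by (intro that[of C]) auto
qed

text \<open>The constant is the minimum over the compact unit sphere. The function is abstract so
  that the lemma covers matrices as well as the rotated cost on pairs \<open>(x, u)\<close>.\<close>

lemma homogeneous_coercive:
  fixes f :: "'a::euclidean_space \<Rightarrow> real"
  assumes "continuous_on UNIV f" and "\<And>c x. f (c *\<^sub>R x) = c\<^sup>2 * f x"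
    and "\<And>x. x \<noteq> 0 \<Longrightarrow> f x > 0"
  obtains e where "e > 0" "\<And>x. f x \<ge> e * (norm x)\<^sup>2"
proof -
  have "compact (sphere (0::'a) 1)" "sphere (0::'a) 1 \<noteq> {}" by auto
  moreover have "continuous_on (sphere (0::'a) 1) f"
    using assms(1) continuous_on_subset by blast
  ultimately obtain m where m: "m \<in> sphere 0 1" "\<And>y. y \<in> sphere 0 1 \<Longrightarrow> f m \<le> f y"
    using continuous_attains_inf[of "sphere 0 1" f] by blast
  have "f x \<ge> f m * (norm x)\<^sup>2" for x
  proof (cases "x = 0")
    case True
    with assms(2)[of 0 x] show ?thesis by simp
  next
    case False
    then have "x = norm x *\<^sub>R (x /\<^sub>R norm x)" by simp
    then have "f x = (norm x)\<^sup>2 * f (x /\<^sub>R norm x)" by (metis assms(2))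
    moreover have "f m \<le> f (x /\<^sub>R norm x)" using False by (intro m(2)) simp
    ultimately show ?thesis by (metis mult.commute mult_left_mono zero_le_power2)
  qed
  moreover have "f m > 0" using m(1) by (intro assms(3)) auto
  ultimately show ?thesis using that by blast
qed

lemma positive_definite_iff:
  "positive_definite M \<longleftrightarrow> symmetric_matrix M \<and> (\<forall>x. x \<noteq> 0 \<longrightarrow> quad_form M x > 0)"
  by (simp add: positive_definite_def quad_form_def)

lemma positive_definite_invertible:
  assumes "positive_definite M" shows "invertible M"
proof -
  have "x = 0" if "M *v x = 0" for x
    using assms that unfolding positive_definite_def by (metis inner_zero_right less_irrefl)
  then show ?thesis by (simp add: invertible_left_inverse matrix_left_invertible_ker)
qed

lemma quad_form_coercive:
  assumes "positive_definite M"
  obtains e where "e > 0" "\<And>x. quad_form M x \<ge> e * (norm x)\<^sup>2"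
proof (rule homogeneous_coercive[of "quad_form M"])
  show "continuous_on UNIV (quad_form M)"
    using continuous_on_quad_form[OF continuous_on_id, of UNIV M] by simp
qed (use assms in \<open>auto simp: quad_form_scaleR positive_definite_iff\<close>)

subsection \<open>The stage cost and block matrices\<close>

text \<open>Works on pairs instead of vectors over a sum type; the factor 2 merges the two
  off-diagonal blocks.\<close>

definition lq_cost :: "real^'n^'n \<Rightarrow> real^'n^'m \<Rightarrow> real^'m^'m \<Rightarrow> real^'n \<Rightarrow> real^'m \<Rightarrow> real"
  where "lq_cost Q S R x u = quad_form Q x + 2 * (u \<bullet> (S *v x)) + quad_form R u"

lemma sum_UNIV_sum_type:
  "sum f (UNIV :: ('a::finite + 'b::finite) set) = (\<Sum>a\<in>UNIV. f (Inl a)) + (\<Sum>b\<in>UNIV. f (Inr b))"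
  unfolding UNIV_Plus_UNIV[symmetric] by (subst sum.Plus) auto

lemma inner_stack: "stack x u \<bullet> stack y v = x \<bullet> y + u \<bullet> v"
  by (simp add: inner_vec_def stack_def sum_UNIV_sum_type)

lemma stack_eq_zero_iff: "stack x u = 0 \<longleftrightarrow> x = 0 \<and> u = 0"
  by (metis inner_eq_zero_iff inner_stack add_nonneg_eq_0_iff inner_ge_zero)

lemma block_matrix_mult_stack:
  "block_matrix M11 M12 M21 M22 *v stack x u = stack (M11 *v x + M12 *v u) (M21 *v x + M22 *v u)"
proof -
  have "(block_matrix M11 M12 M21 M22 *v stack x u) $ i
      = stack (M11 *v x + M12 *v u) (M21 *v x + M22 *v u) $ i" for i
    by (cases i) (simp_all add: block_matrix_def stack_def matrix_vector_mult_def sum_UNIV_sum_type)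
  then show ?thesis by (simp add: vec_eq_iff)
qed

lemma stage_cost_cost_matrix: "stage_cost (cost_matrix Q S R) x u = lq_cost Q S R x u"
  by (simp add: stage_cost_def cost_matrix_def block_matrix_mult_stack inner_stack
      lq_cost_def quad_form_def bilinear_expand inner_commute)

text \<open>The usual reading of dissipativity: \<open>L\<close> is the storage, and the rotated
  form is the supply \<open>lq_cost\<close> minus the storage increase along one step.\<close>

lemma quad_form_rotated_cost_matrix:
  assumes "symmetric_matrix L"
  shows "quad_form (rotated_cost_matrix A B Q S R L) (stack x u)
    = lq_cost Q S R x u + quad_form L x - quad_form L (A *v x + B *v u)"
  using symmetric_matrixD[OF assms, of "A *v x" "B *v u"]
  by (simp add: quad_form_def rotated_cost_matrix_def block_matrix_mult_stack inner_stack
      lq_cost_def bilinear_expand inner_commute)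

lemma symmetric_cost_matrixD:
  assumes "symmetric_matrix (cost_matrix Q S R)"
  shows "symmetric_matrix Q" "symmetric_matrix R"
proof -
  have *: "stack x u \<bullet> (cost_matrix Q S R *v stack y v) = stack y v \<bullet> (cost_matrix Q S R *v stack x u)"
    for x y u v using assms by (rule symmetric_matrixD)
  show "symmetric_matrix Q"
    using *[of _ 0 _ 0] by (simp add: symmetric_matrix_iff cost_matrix_def block_matrix_mult_stack inner_stack)
  show "symmetric_matrix R"
    using *[of 0 _ 0] by (simp add: symmetric_matrix_iff cost_matrix_def block_matrix_mult_stack inner_stack)
qed

text \<open>The pointwise form is the one that transports easily under input substitutions and time
  reversal, with \<open>L\<close> kept visible.\<close>

definition dissipative_with ::
  "real^'n^'n \<Rightarrow> real^'m^'n \<Rightarrow> real^'n^'n \<Rightarrow> real^'n^'m \<Rightarrow> real^'m^'m \<Rightarrow> real^'n^'n \<Rightarrow> bool"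
  where "dissipative_with A B Q S R L \<longleftrightarrow> symmetric_matrix L \<and>
    (\<forall>x u. (x, u) \<noteq> (0, 0) \<longrightarrow>
      lq_cost Q S R x u + quad_form L x - quad_form L (A *v x + B *v u) > 0)"

lemma pre_dissipative_imp_dissipative_with:
  assumes "quadratic_strict_xu_pre_dissipative A B Q S R"
  obtains L where "dissipative_with A B Q S R L"
proof -
  obtain L where L: "symmetric_matrix L" "positive_definite (rotated_cost_matrix A B Q S R L)"
    using assms unfolding quadratic_strict_xu_pre_dissipative_def by blast
  have "lq_cost Q S R x u + quad_form L x - quad_form L (A *v x + B *v u) > 0"
    if "(x, u) \<noteq> (0, 0)" for x u
    using L(2) that unfolding positive_definite_iff quad_form_rotated_cost_matrix[OF L(1), symmetric]
    by (metis stack_eq_zero_iff)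
  with L(1) show ?thesis by (intro that) (auto simp: dissipative_with_def)
qed

lemma dissipative_with_coercive:
  fixes A :: "real^'n^'n" and B :: "real^'m^'n"
  assumes "dissipative_with A B Q S R L"
  obtains e where "e > 0"
    "\<And>x u. lq_cost Q S R x u + quad_form L x - quad_form L (A *v x + B *v u)
      \<ge> e * ((norm x)\<^sup>2 + (norm u)\<^sup>2)"
proof (rule homogeneous_coercive[of
    "\<lambda>(x, u). lq_cost Q S R x u + quad_form L x - quad_form L (A *v x + B *v u)"])
  show "continuous_on UNIV (\<lambda>(x, u). lq_cost Q S R x u + quad_form L x - quad_form L (A *v x + B *v u))"
    unfolding lq_cost_def case_prod_unfold by (intro continuous_intros)
  fix c :: real and w :: "(real^'n) \<times> (real^'m)"
  obtain x u where w: "w = (x, u)" by force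
  have "quad_form L (A *v (c *\<^sub>R x) + B *v (c *\<^sub>R u)) = c\<^sup>2 * quad_form L (A *v x + B *v u)"
    by (simp only: matrix_vector_mult_scaleR scaleR_add_right[symmetric] quad_form_scaleR)
  moreover have "lq_cost Q S R (c *\<^sub>R x) (c *\<^sub>R u) = c\<^sup>2 * lq_cost Q S R x u"
    by (simp add: lq_cost_def quad_form_scaleR matrix_vector_mult_scaleR power2_eq_square distrib_left)
  ultimately show "(case c *\<^sub>R w of (x, u) \<Rightarrow> lq_cost Q S R x u + quad_form L x - quad_form L (A *v x + B *v u))
    = c\<^sup>2 * (case w of (x, u) \<Rightarrow> lq_cost Q S R x u + quad_form L x - quad_form L (A *v x + B *v u))"
    by (simp add: w quad_form_scaleR distrib_left right_diff_distrib)
next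
  fix w :: "(real^'n) \<times> (real^'m)"
  assume "w \<noteq> 0"
  with assms show "0 < (case w of (x, u) \<Rightarrow> lq_cost Q S R x u + quad_form L x - quad_form L (A *v x + B *v u))"
    by (auto simp: dissipative_with_def zero_prod_def split: prod.split)
next
  fix e :: real
  assume e: "e > 0" "\<And>w. e * (norm w)\<^sup>2 \<le>
    (case w of (x, u) \<Rightarrow> lq_cost Q S R x u + quad_form L x - quad_form L (A *v x + B *v u))"
  show ?thesis
    using e(2)[of "(_, _)"] by (intro that[OF e(1)]) (simp add: norm_Pair)
qed

subsection \<open>Schur stability\<close>

lemma norm_vector_scalar_mult: "norm (z *s (v :: complex^'n)) = cmod z * norm v"
  by (simp add: norm_vec_def norm_mult L2_set_right_distrib)

lemma matrix_vector_mult_sum: "N *v (\<Sum>i\<in>I. f i) = (\<Sum>i\<in>I. N *v f i)" for N :: "complex^'n^'m"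
  by (induction I rule: infinite_finite_induct) (simp_all add: matrix_vector_right_distrib)

text \<open>The vector \<open>p(N) v\<close>, written with iterates of \<open>N\<close> on
  \<open>v\<close> rather than matrix powers.\<close>

definition poly_apply :: "complex^'n^'n \<Rightarrow> complex poly \<Rightarrow> complex^'n \<Rightarrow> complex^'n"
  where "poly_apply N p v = (\<Sum>i\<le>degree p. coeff p i *s (((*v) N ^^ i) v))"

lemma poly_apply_eq_sum:
  assumes "degree p \<le> n"
  shows "poly_apply N p v = (\<Sum>i\<le>n. coeff p i *s (((*v) N ^^ i) v))"
  unfolding poly_apply_def
  by (rule sum.mono_neutral_left) (use assms in \<open>auto simp: coeff_eq_0\<close>)

lemma poly_apply_linear_factor:
  "poly_apply N ([:- z, 1:] * q) v = N *v poly_apply N q v - z *s poly_apply N q v"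
proof -
  let ?a = "\<lambda>i. ((*v) N ^^ i) v"
  have "degree ([:- z, 1:] * q) \<le> Suc (degree q)"
    using degree_mult_le[of "[:- z, 1:]" q] by simp
  then have "poly_apply N ([:- z, 1:] * q) v
      = (\<Sum>i\<le>Suc (degree q). coeff (pCons 0 q) i *s ?a i - z *s (coeff q i *s ?a i))"
    by (subst poly_apply_eq_sum) (auto intro!: sum.cong simp: vector_sub_rdistrib vector_smult_assoc)
  also have "\<dots> = (\<Sum>i\<le>Suc (degree q). coeff (pCons 0 q) i *s ?a i)
      - z *s (\<Sum>i\<le>Suc (degree q). coeff q i *s ?a i)"
    by (simp only: sum_subtractf vec.scale_sum_right)
  also have "(\<Sum>i\<le>Suc (degree q). coeff (pCons 0 q) i *s ?a i) = N *v poly_apply N q v"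
    by (subst sum.atMost_Suc_shift)
      (simp add: poly_apply_def matrix_vector_mult_sum vector_scalar_commute)
  also have "(\<Sum>i\<le>Suc (degree q). coeff q i *s ?a i) = poly_apply N q v"
    by (rule poly_apply_eq_sum[symmetric]) simp
  finally show ?thesis .
qed

lemma funpow_matrix_diff_scale:
  "((*v) N ^^ i) (N *v v - z *s v) = N *v (((*v) N ^^ i) v) - z *s (((*v) N ^^ i) v)"
  for N :: "complex^'n^'n"
  by (induction i) (simp_all add: matrix_vector_mult_diff_distrib vector_scalar_commute)

text \<open>\<open>N - z\<close> commutes with the powers of \<open>N\<close>, so it may act first
  instead of last. Acting last, it is cancelled when \<open>z\<close> is no eigenvalue; acting
  first, it shows that \<open>q\<close> annihilates \<open>N v - z v\<close>.\<close>

lemma poly_apply_linear_factor':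
  "poly_apply N ([:- z, 1:] * q) v = poly_apply N q (N *v v - z *s v)"
proof -
  have "poly_apply N q (N *v v - z *s v)
      = (\<Sum>i\<le>degree q. N *v (coeff q i *s (((*v) N ^^ i) v)) - z *s (coeff q i *s (((*v) N ^^ i) v)))"
    unfolding poly_apply_def funpow_matrix_diff_scale
    by (intro sum.cong refl) (simp add: vec.scale_right_diff_distrib vector_scalar_commute vector_smult_assoc mult.commute)
  also have "\<dots> = N *v poly_apply N q v - z *s poly_apply N q v"
    by (simp only: poly_apply_def matrix_vector_mult_sum vec.scale_sum_right sum_subtractf)
  finally show ?thesis
    by (simp only: poly_apply_linear_factor)
qed

text \<open>Dimension count: \<open>CARD('n) + 1\<close> iterates of one vector are linearly
  dependent.\<close>

lemma ex_annihilating_poly: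
  fixes N :: "complex^'n^'n" and v :: "complex^'n"
  shows "\<exists>p. p \<noteq> 0 \<and> poly_apply N p v = 0"
proof -
  let ?n = "CARD('n)"
  define a where "a i = ((*v) N ^^ i) v" for i
  have "\<exists>c. (\<exists>i\<le>?n. c i \<noteq> 0) \<and> (\<Sum>i\<le>?n. c i *s a i) = 0"
  proof (cases "inj_on a {..?n}")
    case True
    have "card (a ` {..?n}) > vec.dim (UNIV :: (complex^'n) set)"
      using card_image[OF True] by (simp add: vec_dim_card card_cart_basis)
    then have "vec.dependent (a ` {..?n})"
      using vec.independent_bound_general[of "a ` {..?n}"]
        vec.dim_subset[of "a ` {..?n}" UNIV] by force
    then obtain u where u: "\<exists>w\<in>a ` {..?n}. u w \<noteq> 0" "(\<Sum>w\<in>a ` {..?n}. u w *s w) = 0"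
      by (auto simp: vec.dependent_finite)
    have "(\<Sum>i\<le>?n. u (a i) *s a i) = 0"
      using u(2) by (simp add: sum.reindex[OF True])
    with u(1) show ?thesis by (intro exI[of _ "u \<circ> a"]) auto
  next
    case False
    then obtain i j where ij: "i \<le> ?n" "j \<le> ?n" "i \<noteq> j" "a i = a j"
      by (auto simp: inj_on_def)
    \<comment> \<open>Coinciding iterates make the set too small for the dimension count, but then
      \<open>X^i - X^j\<close> annihilates \<open>v\<close>.\<close>
    let ?c = "\<lambda>k. (if k = i then 1 else 0) - (if k = j then 1 else 0 :: complex)"
    have "(\<Sum>k\<le>?n. ?c k *s a k) = (\<Sum>k\<le>?n. (if k = i then a k else 0) - (if k = j then a k else 0))"
      by (intro sum.cong) auto
    also have "\<dots> = 0"
      using ij by (simp add: sum_subtractf)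
    finally show ?thesis using ij by (intro exI[of _ ?c]) auto
  qed
  then obtain c j where c: "j \<le> ?n" "c j \<noteq> 0" "(\<Sum>i\<le>?n. c i *s a i) = 0" by blast
  define p where "p = (\<Sum>i\<le>?n. monom (c i) i)"
  have coeff_p: "coeff p i = (if i \<le> ?n then c i else 0)" for i
    by (simp add: p_def coeff_sum)
  have "degree p \<le> ?n"
    by (rule degree_le) (simp add: coeff_p)
  then have "poly_apply N p v = 0"
    using c(3) by (simp add: poly_apply_eq_sum coeff_p a_def)
  moreover have "p \<noteq> 0" using c coeff_p[of j] by auto
  ultimately show ?thesis by blast
qed

text \<open>Summing the recursion bounds \<open>1 - r\<close> times each partial sum of
  \<open>a\<close> by \<open>a 0 + suminf b\<close>.\<close>

lemma summable_affine_recursion: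
  fixes a b :: "nat \<Rightarrow> real"
  assumes "\<And>k. a k \<ge> 0" "\<And>k. b k \<ge> 0" "summable b" "r \<ge> 0" "r < 1"
    and step: "\<And>k. a (Suc k) \<le> r * a k + b k"
  shows "summable a"
proof (rule summableI_nonneg_bounded)
  fix n
  have "(\<Sum>k<n. a k) \<le> (\<Sum>k<Suc n. a k)"
    using assms(1) by simp
  also have "\<dots> = a 0 + (\<Sum>k<n. a (Suc k))"
    by (rule sum.lessThan_Suc_shift)
  also have "\<dots> \<le> a 0 + (\<Sum>k<n. r * a k + b k)"
    by (intro add_left_mono sum_mono step)
  also have "\<dots> = a 0 + r * (\<Sum>k<n. a k) + (\<Sum>k<n. b k)"
    by (simp add: sum.distrib sum_distrib_left)
  also have "(\<Sum>k<n. b k) \<le> suminf b"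
    by (intro sum_le_suminf assms) auto
  finally have "(1 - r) * (\<Sum>k<n. a k) \<le> a 0 + suminf b"
    by (simp add: algebra_simps)
  then show "(\<Sum>k<n. a k) \<le> (a 0 + suminf b) / (1 - r)"
    using assms by (simp add: field_simps)
qed (use assms in auto)

text \<open>Induction on the degree of an annihilating polynomial: a linear factor \<open>X - z\<close> with
  \<open>z\<close> not an eigenvalue can be cancelled, and otherwise \<open>cmod z < 1\<close> makes the orbit of
  \<open>v\<close> a contraction driven by the summable orbit of \<open>N v - z v\<close>.\<close>

lemma summable_orbit_annihilated:
  fixes N :: "complex^'n^'n"
  assumes eig: "\<And>z v. v \<noteq> 0 \<Longrightarrow> N *v v = z *s v \<Longrightarrow> cmod z < 1"
    and "p \<noteq> 0" "poly_apply N p v = 0"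
  shows "summable (\<lambda>k. norm (((*v) N ^^ k) v))"
  using assms(2,3)
proof (induction "degree p" arbitrary: p v)
  case 0
  then obtain c where "p = [:c:]" "c \<noteq> 0" by (metis degree_eq_zeroE pCons_0_0)
  with 0 have "v = 0" by (simp add: poly_apply_def)
  then have "((*v) N ^^ k) v = 0" for k by (induction k) simp_all
  then show ?case by simp
next
  case (Suc n)
  obtain z where "poly p z = 0"
    using fundamental_theorem_of_algebra[of p] Suc.hyps(2) by (auto simp: constant_degree)
  then obtain q where p: "p = [:- z, 1:] * q"
    by (auto simp: poly_eq_0_iff_dvd dvd_def)
  with Suc.prems(1) have "q \<noteq> 0" by (metis mult_zero_right)
  then have "degree p = Suc (degree q)"
    unfolding p by (subst degree_mult_eq) simp_all
  with \<open>q \<noteq> 0\<close> Suc.hyps(2) have q: "q \<noteq> 0" "n = degree q" by simp_all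
  show ?case
  proof (cases "cmod z < 1")
    case True
    have "summable (\<lambda>k. norm (((*v) N ^^ k) (N *v v - z *s v)))"
      using Suc.prems(2) by (intro Suc.hyps(1)[OF q(2,1)]) (simp only: p poly_apply_linear_factor')
    then show ?thesis
    proof (rule summable_affine_recursion[rotated 2])
      fix k
      have "((*v) N ^^ Suc k) v = z *s (((*v) N ^^ k) v) + ((*v) N ^^ k) (N *v v - z *s v)"
        by (simp add: funpow_matrix_diff_scale)
      then show "norm (((*v) N ^^ Suc k) v)
          \<le> cmod z * norm (((*v) N ^^ k) v) + norm (((*v) N ^^ k) (N *v v - z *s v))"
        by (metis norm_triangle_ineq norm_vector_scalar_mult)
    qed (use True in auto)
  next
    case False
    have "N *v poly_apply N q v = z *s poly_apply N q v"
      using Suc.prems(2) by (simp only: p poly_apply_linear_factor right_minus_eq)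
    with eig False have "poly_apply N q v = 0" by blast
    then show ?thesis by (intro Suc.hyps(1)[OF q(2,1)])
  qed
qed

section \<open>Transfer between real orbits and complex eigenvalues\<close>

definition complexify :: "real^'n \<Rightarrow> complex^'n"
  where "complexify x = (\<chi> i. complex_of_real (x $ i))"

lemma map_matrix_of_real_complexify:
  "map_matrix complex_of_real M *v complexify y = complexify (M *v y)"
proof -
  have "(map_matrix complex_of_real M *v complexify y) $ i = complexify (M *v y) $ i" for i
    unfolding complexify_def matrix_vector_mult_def map_matrix_def
    by (simp only: vec_lambda_beta of_real_sum of_real_mult)
  then show ?thesis by (simp only: vec_eq_iff) blast
qed

lemma funpow_complexify:
  fixes M :: "real^'n^'n"
  shows "((*v) (map_matrix complex_of_real M) ^^ k) (complexify x) = complexify (((*v) M ^^ k) x)"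
  by (induction k) (simp_all only: funpow.simps id_apply o_apply map_matrix_of_real_complexify)

lemma norm_complexify [simp]: "norm (complexify x) = norm x"
  by (simp add: norm_vec_def complexify_def)

lemma schur_stable_imp_tendsto_zero:
  assumes "schur_stable M"
  shows "(\<lambda>k. ((*v) M ^^ k) x) \<longlonglongrightarrow> 0"
proof -
  let ?N = "map_matrix complex_of_real M"
  obtain p where p: "p \<noteq> 0" "poly_apply ?N p (complexify x) = 0"
    using ex_annihilating_poly[of ?N "complexify x"] by auto
  have "cmod z < 1" if "v \<noteq> 0" "?N *v v = z *s v" for z v
  proof -
    have "complex_eigenvalue M z"
      unfolding complex_eigenvalue_def using that by (intro exI[of _ v] conjI)
    with assms show ?thesis by (simp add: schur_stable_def)
  qed
  from summable_orbit_annihilated[OF this p]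
  have "summable (\<lambda>k. norm (((*v) ?N ^^ k) (complexify x)))" .
  then have "summable (\<lambda>k. norm (((*v) M ^^ k) x))"
    by (simp only: funpow_complexify norm_complexify)
  then show ?thesis
    by (rule tendsto_norm_zero_cancel[OF summable_LIMSEQ_zero])
qed

text \<open>An eigenvector is complex while the hypothesis concerns real orbits, so its real and
  imaginary parts are iterated separately.\<close>

lemma tendsto_zero_imp_schur_stable:
  fixes M :: "real^'n^'n"
  assumes "\<And>x. (\<lambda>k. ((*v) M ^^ k) x) \<longlonglongrightarrow> 0"
  shows "schur_stable M"
  unfolding schur_stable_def
proof (intro allI impI)
  fix z assume "complex_eigenvalue M z"
  then obtain v where v: "v \<noteq> 0" "map_matrix complex_of_real M *v v = z *s v"
    by (auto simp: complex_eigenvalue_def)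
  then obtain i where i: "v $ i \<noteq> 0" by (auto simp: vec_eq_iff)
  \<comment> \<open>\<open>f\<close> will be \<open>Re\<close> and \<open>Im\<close>. Applied
    entrywise, a real-linear \<open>f\<close> commutes with a real matrix, so the orbit of
    \<open>f v\<close> is \<open>f\<close> of \<open>z ^ k *s v\<close>.\<close>
  have part: "(\<lambda>k. f (z ^ k * v $ i)) \<longlonglongrightarrow> 0"
    if f: "\<And>a b. f (a + b) = f a + f b" "\<And>r c. f (complex_of_real r * c) = r * f c"
    for f :: "complex \<Rightarrow> real"
  proof -
    have f_sum: "f (sum g UNIV) = (\<Sum>j\<in>UNIV. f (g j))" for g :: "'n \<Rightarrow> complex"
    proof -
      have "f 0 = 0" using f(2)[of 0 0] by simp
      then have "f (sum g I) = (\<Sum>j\<in>I. f (g j))" for I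
        by (induction I rule: infinite_finite_induct) (simp_all add: f)
      then show ?thesis .
    qed
    have comm: "(\<chi> j. f ((z *s w) $ j)) = M *v (\<chi> j. f (w $ j))"
      if "map_matrix complex_of_real M *v w = z *s w" for w
      unfolding that[symmetric]
      by (simp add: vec_eq_iff matrix_vector_mult_def map_matrix_def f_sum f)
    have "((*v) M ^^ k) (\<chi> j. f (v $ j)) = (\<chi> j. f ((z ^ k *s v) $ j))" for k
    proof (induction k)
      case (Suc k)
      have "map_matrix complex_of_real M *v (z ^ k *s v) = z *s (z ^ k *s v)"
        by (simp only: vector_scalar_commute v(2) vector_smult_assoc mult.commute)
      from comm[OF this] Suc show ?case
        by (simp add: vector_smult_assoc mult.assoc)
    qed simp
    then have "(\<lambda>k. \<chi> j. f ((z ^ k *s v) $ j)) \<longlonglongrightarrow> 0"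
      using assms[of "\<chi> j. f (v $ j)"] by simp
    from tendsto_vec_nth[OF this, of i] show ?thesis by simp
  qed
  have "(\<lambda>k. z ^ k * v $ i) \<longlonglongrightarrow> 0"
    unfolding tendsto_complex_iff using part[OF plus_complex.sel(1)] part[OF plus_complex.sel(2)]
    by simp
  then have "(\<lambda>k. z ^ k * v $ i / v $ i) \<longlonglongrightarrow> 0 / v $ i"
    by (intro tendsto_divide tendsto_const i)
  then have lim: "(\<lambda>k. z ^ k) \<longlonglongrightarrow> 0" using i by simp
  show "cmod z < 1"
  proof (rule ccontr)
    assume "\<not> cmod z < 1"
    then have "norm (z ^ k) \<ge> 1" for k by (simp add: norm_power)
    moreover have "eventually (\<lambda>k. norm (z ^ k) < 1) sequentially"
      using tendstoD[OF lim, of 1] by simp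
    ultimately have "eventually (\<lambda>k::nat. False) sequentially"
      by (simp add: not_less[symmetric])
    then show False by simp
  qed
qed

subsection \<open>Solutions of the algebraic Riccati equation\<close>

definition dare_map ::
  "real^'n^'n \<Rightarrow> real^'m^'n \<Rightarrow> real^'n^'n \<Rightarrow> real^'n^'m \<Rightarrow> real^'m^'m \<Rightarrow> real^'n^'n \<Rightarrow> real^'n^'n"
  where "dare_map A B Q S R P = Q + transpose A ** P ** A
    - (transpose S + transpose A ** P ** B) ** dare_gain A B S R P"

lemma dare_solution_iff:
  "dare_solution A B Q S R P \<longleftrightarrow> symmetric_matrix P \<and>
    invertible (R + transpose B ** P ** B) \<and> dare_map A B Q S R P = P"
  by (auto simp: dare_solution_def dare_map_def)

lemma matrix_inv_cancel:
  assumes "invertible M"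
  shows "M ** matrix_inv M = mat 1" "matrix_inv M ** M = mat 1"
proof -
  have "M ** matrix_inv M = mat 1 \<and> matrix_inv M ** M = mat 1"
    using assms unfolding invertible_def matrix_inv_def by (rule someI_ex)
  then show "M ** matrix_inv M = mat 1" "matrix_inv M ** M = mat 1" by auto
qed

lemma dare_gain_mult:
  assumes "invertible (R + transpose B ** P ** B)"
  shows "(R + transpose B ** P ** B) *v (dare_gain A B S R P *v x) = (S + transpose B ** P ** A) *v x"
  unfolding dare_gain_def
  by (simp add: matrix_vector_mul_assoc matrix_mul_assoc matrix_inv_cancel[OF assms])

text \<open>The gain equation tested against \<open>u\<close>; the identities below for
  \<open>dare_map\<close> use the inverse only in this form.\<close>

lemma inner_dare_gain:
  assumes "invertible (R + transpose B ** P ** B)"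
  shows "u \<bullet> (R *v (dare_gain A B S R P *v x)) + (B *v u) \<bullet> (P *v (B *v (dare_gain A B S R P *v x)))
    = u \<bullet> (S *v x) + (B *v u) \<bullet> (P *v (A *v x))"
  using arg_cong[OF dare_gain_mult[OF assms, of A S x], of "\<lambda>w. u \<bullet> w"]
  by (simp add: bilinear_expand)

lemma inner_dare_map:
  "x \<bullet> (dare_map A B Q S R P *v y) = x \<bullet> (Q *v y) + (A *v x) \<bullet> (P *v (A *v y))
    - (S *v x) \<bullet> (dare_gain A B S R P *v y)
    - (A *v x) \<bullet> (P *v (B *v (dare_gain A B S R P *v y)))"
  by (simp add: dare_map_def bilinear_expand)

lemma symmetric_dare_map:
  assumes "symmetric_matrix Q" "symmetric_matrix R" "symmetric_matrix P"
    and "invertible (R + transpose B ** P ** B)"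
  shows "symmetric_matrix (dare_map A B Q S R P)"
  unfolding symmetric_matrix_iff
proof (intro allI)
  fix x y
  let ?K = "dare_gain A B S R P"
  show "x \<bullet> (dare_map A B Q S R P *v y) = y \<bullet> (dare_map A B Q S R P *v x)"
    using inner_dare_gain[OF assms(4), of "?K *v y" A S x] inner_dare_gain[OF assms(4), of "?K *v x" A S y]
      symmetric_matrixD[OF assms(1), of x y] symmetric_matrixD[OF assms(2), of "?K *v x" "?K *v y"]
      symmetric_matrixD[OF assms(3), of "A *v x" "A *v y"]
      symmetric_matrixD[OF assms(3), of "A *v x" "B *v (?K *v y)"]
      symmetric_matrixD[OF assms(3), of "A *v y" "B *v (?K *v x)"]
      symmetric_matrixD[OF assms(3), of "B *v (?K *v x)" "B *v (?K *v y)"]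
    unfolding inner_dare_map by (simp add: inner_commute)
qed

text \<open>\<open>P\<close> is not assumed to be a fixed point, so the identity also describes a
  single step of value iteration.\<close>

lemma lq_cost_complete_square:
  assumes "symmetric_matrix R" "symmetric_matrix P" "invertible (R + transpose B ** P ** B)"
  shows "lq_cost Q S R x u + quad_form P (A *v x + B *v u)
    = quad_form (dare_map A B Q S R P) x
      + quad_form (R + transpose B ** P ** B) (u + dare_gain A B S R P *v x)"
proof -
  let ?K = "dare_gain A B S R P"
  show ?thesis
    using inner_dare_gain[OF assms(3), of u A S x] inner_dare_gain[OF assms(3), of "?K *v x" A S x]
      symmetric_matrixD[OF assms(1), of u "?K *v x"]
      symmetric_matrixD[OF assms(2), of "A *v x" "B *v u"]
      symmetric_matrixD[OF assms(2), of "A *v x" "B *v (?K *v x)"]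
      symmetric_matrixD[OF assms(2), of "B *v u" "B *v (?K *v x)"]
    unfolding quad_form_def[of "dare_map A B Q S R P"] inner_dare_map
    by (simp add: lq_cost_def quad_form_def bilinear_expand inner_commute)
qed

text \<open>For \<open>M = A - B K\<close> the equation reads \<open>A^T P M = P - Q + S^T K\<close>
  and \<open>B^T P M = R K - S\<close>; this combines both. The vector \<open>w\<close> stays free
  so that the gain of another solution can be inserted.\<close>

lemma inner_dare_solution_closed_loop:
  assumes "symmetric_matrix R" "dare_solution A B Q S R P"
  shows "((A - B ** dare_gain A B S R P) *v x) \<bullet> (P *v (A *v y - B *v w))
    = x \<bullet> (P *v y) - x \<bullet> (Q *v y) + (dare_gain A B S R P *v x) \<bullet> (S *v y)
      + (S *v x) \<bullet> w - (dare_gain A B S R P *v x) \<bullet> (R *v w)"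
proof -
  let ?K = "dare_gain A B S R P"
  have P: "symmetric_matrix P" "invertible (R + transpose B ** P ** B)" "dare_map A B Q S R P = P"
    using assms(2) by (auto simp: dare_solution_iff)
  show ?thesis
    using inner_dare_gain[OF P(2), of w A S x] inner_dare_gain[OF P(2), of "?K *v x" A S y]
      inner_dare_gain[OF P(2), of "?K *v y" A S x]
      symmetric_matrixD[OF assms(1), of w "?K *v x"] symmetric_matrixD[OF assms(1), of "?K *v y" "?K *v x"]
      symmetric_matrixD[OF P(1), of "A *v x" "B *v w"]
      symmetric_matrixD[OF P(1), of "B *v (?K *v x)" "B *v w"]
      symmetric_matrixD[OF P(1), of "A *v x" "B *v (?K *v y)"]
      symmetric_matrixD[OF P(1), of "B *v (?K *v x)" "B *v (?K *v y)"]
      inner_dare_map[of x A B Q S R P y]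
    unfolding P(3) by (simp add: bilinear_expand inner_commute)
qed

text \<open>The difference \<open>X\<close> of two stabilizing solutions satisfies
  \<open>x \<bullet> X y = (M\<^sub>1 x) \<bullet> X (M\<^sub>2 y)\<close> for the two closed-loop matrices.\<close>

lemma dare_stabilizing_solution_unique:
  fixes P1 P2 :: "real^'n^'n"
  assumes Q: "symmetric_matrix Q" and R: "symmetric_matrix R"
    and P1: "dare_stabilizing_solution A B Q S R P1" and P2: "dare_stabilizing_solution A B Q S R P2"
  shows "P1 = P2"
proof -
  define M1 where "M1 = A - B ** dare_gain A B S R P1"
  define M2 where "M2 = A - B ** dare_gain A B S R P2"
  have sol: "dare_solution A B Q S R P1" "dare_solution A B Q S R P2"
    and stable: "schur_stable M1" "schur_stable M2"
    using P1 P2 by (auto simp: dare_stabilizing_solution_def M1_def M2_def)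
  then have sym: "symmetric_matrix P1" "symmetric_matrix P2" by (auto simp: dare_solution_def)
  have step: "x \<bullet> ((P1 - P2) *v y) = (M1 *v x) \<bullet> ((P1 - P2) *v (M2 *v y))" for x y
  proof -
    have M: "M1 *v x = A *v x - B *v (dare_gain A B S R P1 *v x)"
      "M2 *v y = A *v y - B *v (dare_gain A B S R P2 *v y)"
      by (simp_all add: M1_def M2_def matrix_vector_expand)
    \<comment> \<open>Each gain is inserted into the identity of the other solution, at exchanged
      arguments. Both then contain the same mixed terms in \<open>S\<close> and \<open>R\<close>,
      which cancel.\<close>
    have "(M1 *v x) \<bullet> (P1 *v (M2 *v y)) - (M2 *v y) \<bullet> (P2 *v (M1 *v x))
        = x \<bullet> (P1 *v y) - y \<bullet> (P2 *v x) - x \<bullet> (Q *v y) + y \<bullet> (Q *v x)"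
      using inner_dare_solution_closed_loop[OF R sol(1), of x y "dare_gain A B S R P2 *v y"]
        inner_dare_solution_closed_loop[OF R sol(2), of y x "dare_gain A B S R P1 *v x"]
        symmetric_matrixD[OF R, of "dare_gain A B S R P1 *v x" "dare_gain A B S R P2 *v y"]
      unfolding M1_def[symmetric] M2_def[symmetric] M[symmetric] by (simp add: inner_commute)
    moreover have "x \<bullet> (Q *v y) = y \<bullet> (Q *v x)"
      by (rule symmetric_matrixD[OF Q])
    ultimately show ?thesis
      using symmetric_matrixD[OF sym(2), of "M2 *v y" "M1 *v x"] symmetric_matrixD[OF sym(2), of y x]
      by (simp add: matrix_vector_expand inner_diff_right)
  qed
  have "x \<bullet> ((P1 - P2) *v y) = 0" for x y
  proof -
    have "x \<bullet> ((P1 - P2) *v y) = (((*v) M1 ^^ k) x) \<bullet> ((P1 - P2) *v (((*v) M2 ^^ k) y))" for k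
      by (induction k) (simp_all flip: step)
    moreover have "(\<lambda>k. (((*v) M1 ^^ k) x) \<bullet> ((P1 - P2) *v (((*v) M2 ^^ k) y))) \<longlonglongrightarrow> 0 \<bullet> ((P1 - P2) *v 0)"
      by (intro tendsto_inner bounded_linear.tendsto[OF matrix_vector_mul_bounded_linear]
          schur_stable_imp_tendsto_zero stable)
    ultimately show ?thesis by (simp add: LIMSEQ_const_iff)
  qed
  then have "(P1 - P2) $ i $ j = 0" for i j
    unfolding matrix_nth_eq_inner by blast
  then have "P1 - P2 = 0"
    by (simp add: vec_eq_iff)
  then show ?thesis by simp
qed

section \<open>Change of sign of all data\<close>

lemma invertible_minus:
  assumes "invertible (M :: real^'n^'n)"
  shows "invertible (- M)" and "matrix_inv (- M) = - matrix_inv M"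
proof -
  have *: "(- M) ** (- matrix_inv M) = mat 1"
    by (simp add: matrix_eq matrix_vector_mul_assoc[symmetric])
       (simp add: matrix_vector_mul_assoc matrix_inv_cancel[OF assms])
  then show inv: "invertible (- M)"
    using invertible_right_inverse by blast
  show "matrix_inv (- M) = - matrix_inv M"
    by (metis * inv matrix_inv_cancel(2) matrix_mul_assoc matrix_mul_lid matrix_mul_rid)
qed

text \<open>Both factors of the gain change sign, so the gain and the closed loop stay the same.
  This turns the RDARE, whose data carry the negated cost, into a minimization problem.\<close>

lemma dare_stabilizing_solution_minus:
  assumes "dare_stabilizing_solution A B Q S R P"
  shows "dare_stabilizing_solution A B (- Q) (- S) (- R) (- P)"
proof -
  let ?W = "R + transpose B ** P ** B"
  have P: "symmetric_matrix P" "invertible ?W" "dare_map A B Q S R P = P"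
    "schur_stable (A - B ** dare_gain A B S R P)"
    using assms by (auto simp: dare_stabilizing_solution_def dare_solution_iff)
  have W: "- R + transpose B ** (- P) ** B = - ?W"
    by (simp add: matrix_eq matrix_vector_expand)
  have inv: "invertible (- ?W)" by (rule invertible_minus[OF P(2)])
  have gain: "dare_gain A B (- S) (- R) (- P) = dare_gain A B S R P"
    unfolding dare_gain_def W invertible_minus(2)[OF P(2)]
    by (simp add: matrix_eq matrix_vector_mul_assoc[symmetric] matrix_vector_expand)
  have "- x \<bullet> (dare_map A B (- Q) (- S) (- R) (- P) *v y) = x \<bullet> (dare_map A B Q S R P *v y)" for x y
    unfolding inner_dare_map gain inner_minus_left by (simp)
  then have "dare_map A B (- Q) (- S) (- R) (- P) = - P"
    unfolding P(3) by (simp add: vec_eq_iff matrix_nth_eq_inner) (metis inner_minus_left minus_equation_iff)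
  with P inv W gain show ?thesis
    by (simp add: dare_stabilizing_solution_def dare_solution_iff)
qed

subsection \<open>Value iteration\<close>

text \<open>Interpreted twice: for the given data with storage \<open>L\<close>, and for the
  time-reversed, negated data with storage \<open>- L\<close>.\<close>

locale dissipative_lq =
  fixes A :: "real^'n^'n" and B :: "real^'m^'n"
    and Q :: "real^'n^'n" and S :: "real^'n^'m" and R :: "real^'m^'m" and L :: "real^'n^'n"
  assumes Q_sym: "symmetric_matrix Q" and R_sym: "symmetric_matrix R"
    and dissipative: "dissipative_with A B Q S R L"
begin

abbreviation "weight P \<equiv> R + transpose B ** P ** B"
abbreviation "gain P \<equiv> dare_gain A B S R P"
abbreviation "ric P \<equiv> dare_map A B Q S R P"

text \<open>\<open>- L\<close> is the lower barrier above which the Riccati map is a minimization;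
  \<open>R\<close> itself may be indefinite.\<close>

definition admissible :: "real^'n^'n \<Rightarrow> bool"
  where "admissible P \<longleftrightarrow> symmetric_matrix P \<and> (\<forall>x. - quad_form L x \<le> quad_form P x)"

lemma L_sym: "symmetric_matrix L"
  using dissipative by (simp add: dissipative_with_def)

text \<open>Dissipativity at state zero makes \<open>R - B^T L B\<close> positive definite, and
  \<open>P >= - L\<close> can only increase it.\<close>

lemma weight_positive_definite:
  assumes "admissible P"
  shows "positive_definite (weight P)"
  unfolding positive_definite_iff
proof (intro conjI allI impI)
  show "symmetric_matrix (weight P)"
    using assms R_sym by (simp add: admissible_def)
  fix u :: "real^'m" assume "u \<noteq> 0"
  then have "0 < lq_cost Q S R 0 u - quad_form L (B *v u)"
    using dissipative unfolding dissipative_with_def by (metis Pair_inject add.right_neutral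
        add_0 matrix_vector_mult_0_right quad_form_zero)
  also have "\<dots> \<le> lq_cost Q S R 0 u + quad_form P (B *v u)"
    using assms[unfolded admissible_def, THEN conjunct2, THEN spec, of "B *v u"] by simp
  also have "\<dots> = quad_form (weight P) u"
    by (simp add: lq_cost_def quad_form_def bilinear_expand)
  finally show "0 < quad_form (weight P) u" .
qed

lemma complete_square:
  assumes "admissible P"
  shows "lq_cost Q S R x u + quad_form P (A *v x + B *v u)
    = quad_form (ric P) x + quad_form (weight P) (u + gain P *v x)"
  using assms R_sym weight_positive_definite[OF assms]
  by (intro lq_cost_complete_square) (auto simp: admissible_def positive_definite_invertible)

text \<open>With \<open>ric_eq\<close> this identifies \<open>ric\<close> as the Bellman
  operator.\<close>

lemma ric_le:
  assumes "admissible P"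
  shows "quad_form (ric P) x \<le> lq_cost Q S R x u + quad_form P (A *v x + B *v u)"
proof -
  have "0 \<le> quad_form (weight P) (u + gain P *v x)"
    using weight_positive_definite[OF assms] unfolding positive_definite_iff
    by (metis less_eq_real_def quad_form_zero)
  then show ?thesis by (simp add: complete_square[OF assms])
qed

lemma ric_eq:
  assumes "admissible P"
  shows "quad_form (ric P) x = lq_cost Q S R x (- (gain P *v x)) + quad_form P (A *v x + B *v (- (gain P *v x)))"
  by (simp only: complete_square[OF assms]) simp

lemma symmetric_ric: "admissible P \<Longrightarrow> symmetric_matrix (ric P)"
  using Q_sym R_sym weight_positive_definite[of P]
  by (intro symmetric_dare_map) (auto simp: admissible_def positive_definite_invertible)

text \<open>The minimizing input for \<open>P'\<close> is a competitor in the minimization for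
  \<open>P\<close>.\<close>

lemma ric_mono:
  assumes "admissible P" "admissible P'" "\<And>x. quad_form P x \<le> quad_form P' x"
  shows "quad_form (ric P) x \<le> quad_form (ric P') x"
  using ric_le[OF assms(1), of x "- (gain P' *v x)"] ric_eq[OF assms(2), of x]
    assms(3)[of "A *v x + B *v (- (gain P' *v x))"]
  by linarith

lemma rotated_cost_nonneg:
  "0 \<le> lq_cost Q S R x u + quad_form L x - quad_form L (A *v x + B *v u)"
proof (cases "(x, u) = (0, 0)")
  case True
  then show ?thesis by (simp add: lq_cost_def)
next
  case False
  then show ?thesis using dissipative unfolding dissipative_with_def by (simp add: less_imp_le)
qed

text \<open>In terms of \<open>P + L\<close> this is the usual value iteration from zero for the rotated cost.\<close>

primrec value_iter :: "nat \<Rightarrow> real^'n^'n"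
  where "value_iter 0 = - L" | "value_iter (Suc k) = ric (value_iter k)"

text \<open>The two claims need each other: growth keeps the next iterate above \<open>- L\<close>,
  and admissibility makes \<open>ric\<close> monotone, which propagates growth.\<close>

lemma value_iter_increasing:
  "admissible (value_iter k) \<and> (\<forall>x. quad_form (value_iter k) x \<le> quad_form (value_iter (Suc k)) x)"
proof (induction k)
  case 0
  have adm: "admissible (- L)" by (simp add: admissible_def L_sym)
  have "- quad_form L x \<le> quad_form (ric (- L)) x" for x
    using rotated_cost_nonneg[of x "- (gain (- L) *v x)"] ric_eq[OF adm, of x] by simp
  with adm show ?case by simp
next
  case (Suc k)
  then have "admissible (value_iter (Suc k))"
    using symmetric_ric[of "value_iter k"] by (auto simp: admissible_def intro: order_trans)
  with Suc show ?case using ric_mono by simp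
qed

lemma admissible_value_iter: "admissible (value_iter k)"
  using value_iter_increasing by blast

lemma value_iter_mono: "k \<le> l \<Longrightarrow> quad_form (value_iter k) x \<le> quad_form (value_iter l) x"
  by (rule lift_Suc_mono_le[of "\<lambda>k. quad_form (value_iter k) x"])
    (use value_iter_increasing in blast)+

lemma value_iter_le_cost:
  "quad_form (value_iter (k + N)) x
    \<le> (\<Sum>j<N. lq_cost Q S R (trajectory A B x u j) (u j)) + quad_form (value_iter k) (trajectory A B x u N)"
proof (induction N arbitrary: k)
  case (Suc N)
  have "quad_form (value_iter (Suc k)) (trajectory A B x u N)
      \<le> lq_cost Q S R (trajectory A B x u N) (u N) + quad_form (value_iter k) (trajectory A B x u (Suc N))"
    using ric_le[OF admissible_value_iter] by simp
  with Suc[of "Suc k"] show ?case by simp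
qed simp

text \<open>An input reaching the origin after \<open>N\<close> steps removes the terminal term for
  every \<open>k\<close>, so its cost bounds all iterates uniformly.\<close>

lemma value_iter_convergent:
  assumes "controllable A B"
  shows "convergent (\<lambda>k. quad_form (value_iter k) x)"
proof -
  obtain N u where u: "trajectory A B x u N = 0"
    using assms unfolding controllable_def by blast
  have "quad_form (value_iter k) x \<le> (\<Sum>j<N. lq_cost Q S R (trajectory A B x u j) (u j))" for k
    using value_iter_mono[of k "k + N" x] value_iter_le_cost[of k N x u] u by simp
  moreover have "incseq (\<lambda>k. quad_form (value_iter k) x)"
    by (simp add: incseq_def value_iter_mono)
  ultimately show ?thesis
    by (meson convergent_def incseq_convergent)
qed

lemma value_iter_limit:
  assumes "controllable A B"
  obtains P where "value_iter \<longlonglongrightarrow> P"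
proof -
  have "convergent (\<lambda>k. value_iter k $ i $ j)" for i j
    unfolding matrix_nth_eq_inner divide_inverse
      quad_form_polarization[OF admissible_value_iter[unfolded admissible_def, THEN conjunct1]]
    by (intro convergent_diff convergent_mult convergent_const value_iter_convergent assms)
  then have "value_iter \<longlonglongrightarrow> (\<chi> i j. lim (\<lambda>k. value_iter k $ i $ j))"
    by (intro vec_tendstoI) (simp add: convergent_LIMSEQ_iff)
  then show ?thesis by (rule that)
qed

text \<open>One inequality is monotonicity. The other exchanges limit and minimum: by coercivity the
  minimizing inputs are bounded, and a limit point of them attains the value of \<open>P\<close> in
  one step.\<close>

lemma value_iter_limit_fixpoint:
  assumes "value_iter \<longlonglongrightarrow> P"
  shows "admissible P" "ric P = P"
proof -
  have lim: "(\<lambda>k. quad_form (value_iter k) x) \<longlonglongrightarrow> quad_form P x" for x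
    by (intro tendsto_quad_form assms tendsto_const)
  have le: "quad_form (value_iter k) x \<le> quad_form P x" for k x
    by (rule incseq_le[OF _ lim]) (simp add: incseq_def value_iter_mono)
  have sym: "symmetric_matrix P"
    unfolding symmetric_matrix_iff
  proof (intro allI)
    fix x y
    have "(\<lambda>k. x \<bullet> (value_iter k *v y)) \<longlonglongrightarrow> x \<bullet> (P *v y)"
      by (intro tendsto_inner tendsto_matrix_vector_mult tendsto_const assms)
    moreover have "x \<bullet> (value_iter k *v y) = y \<bullet> (value_iter k *v x)" for k
      using admissible_value_iter[of k] by (intro symmetric_matrixD) (simp add: admissible_def)
    moreover have "(\<lambda>k. y \<bullet> (value_iter k *v x)) \<longlonglongrightarrow> y \<bullet> (P *v x)"
      by (intro tendsto_inner tendsto_matrix_vector_mult tendsto_const assms)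
    ultimately show "x \<bullet> (P *v y) = y \<bullet> (P *v x)"
      using LIMSEQ_unique by force
  qed
  show adm: "admissible P"
    using sym le[of 0] by (simp add: admissible_def)
  have "quad_form (ric P) x = quad_form P x" for x
  proof (rule antisym)
    show "quad_form P x \<le> quad_form (ric P) x"
    proof (rule LIMSEQ_le_const2[OF LIMSEQ_Suc[OF lim]])
      show "\<exists>N. \<forall>k\<ge>N. quad_form (value_iter (Suc k)) x \<le> quad_form (ric P) x"
        using ric_mono[OF admissible_value_iter adm le] by simp
    qed
    obtain e where e: "e > 0" "\<And>x u. lq_cost Q S R x u + quad_form L x - quad_form L (A *v x + B *v u)
        \<ge> e * ((norm x)\<^sup>2 + (norm u)\<^sup>2)"
      using dissipative_with_coercive[OF dissipative] by metis
    define u where "u k = - (gain (value_iter k) *v x)" for k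
    have u: "quad_form (value_iter (Suc k)) x
        = lq_cost Q S R x (u k) + quad_form (value_iter k) (A *v x + B *v u k)" for k
      unfolding u_def using ric_eq[OF admissible_value_iter] by simp
    \<comment> \<open>The rotated cost of this step is \<open>value_iter (Suc k) + L\<close> at
      \<open>x\<close>, at most \<open>P + L\<close>, minus \<open>value_iter k + L\<close> at the
      successor, which is nonnegative.\<close>
    have "norm (u k) \<le> sqrt ((quad_form P x + quad_form L x) / e)" for k
    proof (rule real_le_rsqrt)
      have "e * (norm (u k))\<^sup>2 \<le> e * ((norm x)\<^sup>2 + (norm (u k))\<^sup>2)"
        using e(1) by simp
      also have "\<dots> \<le> quad_form P x + quad_form L x"
        using e(2)[of x "u k"] u[of k] le[of "Suc k" x] admissible_value_iter[of k]
        unfolding admissible_def by (smt (verit))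
      finally show "(norm (u k))\<^sup>2 \<le> (quad_form P x + quad_form L x) / e"
        using e(1) by (simp add: field_simps)
    qed
    then have "bounded (range u)" by (auto simp: bounded_iff)
    then obtain u' r where r: "strict_mono (r :: nat \<Rightarrow> nat)" "(u \<circ> r) \<longlonglongrightarrow> u'"
      using bounded_imp_convergent_subsequence by blast
    have "(\<lambda>k. lq_cost Q S R x ((u \<circ> r) k) + quad_form ((value_iter \<circ> r) k) (A *v x + B *v (u \<circ> r) k))
        \<longlonglongrightarrow> lq_cost Q S R x u' + quad_form P (A *v x + B *v u')"
      unfolding lq_cost_def
      by (intro tendsto_intros tendsto_quad_form tendsto_matrix_vector_mult r LIMSEQ_subseq_LIMSEQ[OF assms])
    then have "(\<lambda>k. quad_form (value_iter (Suc (r k))) x)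
        \<longlonglongrightarrow> lq_cost Q S R x u' + quad_form P (A *v x + B *v u')"
      by (simp only: u o_def)
    moreover have "(\<lambda>k. quad_form (value_iter (Suc (r k))) x) \<longlonglongrightarrow> quad_form P x"
      using LIMSEQ_subseq_LIMSEQ[OF LIMSEQ_Suc[OF lim] r(1)] by (simp only: o_def)
    ultimately have "quad_form P x = lq_cost Q S R x u' + quad_form P (A *v x + B *v u')"
      using LIMSEQ_unique by blast
    then show "quad_form (ric P) x \<le> quad_form P x"
      using ric_le[OF adm] by simp
  qed
  then show "ric P = P"
    by (intro symmetric_matrix_eqI symmetric_ric adm sym)
qed

text \<open>\<open>P + L\<close> is a Lyapunov function: nonnegative, and decreasing along the
  closed loop by the rotated cost.\<close>

lemma closed_loop_energy:
  assumes "admissible P" "ric P = P"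
    and "\<And>x u. lq_cost Q S R x u + quad_form L x - quad_form L (A *v x + B *v u)
      \<ge> e * ((norm x)\<^sup>2 + (norm u)\<^sup>2)" "e > 0"
  shows "(\<Sum>k<N. e * (norm (((*v) (A - B ** gain P) ^^ k) x))\<^sup>2) \<le> quad_form (P + L) x"
proof -
  let ?M = "A - B ** gain P"
  have M: "?M *v y = A *v y + B *v (- (gain P *v y))" for y
    by (simp add: matrix_vector_expand)
  have step: "e * (norm y)\<^sup>2 + quad_form (P + L) (?M *v y) \<le> quad_form (P + L) y" for y
  proof -
    have "e * (norm y)\<^sup>2 \<le> e * ((norm y)\<^sup>2 + (norm (- (gain P *v y)))\<^sup>2)"
      using assms(4) by simp
    then show ?thesis
      using assms(3)[of y "- (gain P *v y)"] ric_eq[OF assms(1), of y]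
      unfolding M assms(2) quad_form_add_matrix by linarith
  qed
  have "(\<Sum>k<N. e * (norm (((*v) ?M ^^ k) x))\<^sup>2) + quad_form (P + L) (((*v) ?M ^^ N) x)
      \<le> quad_form (P + L) x"
  proof (induction N)
    case (Suc N)
    with step[of "((*v) ?M ^^ N) x"] show ?case by simp
  qed simp
  moreover have "quad_form (P + L) y \<ge> 0" for y
    using assms(1) unfolding admissible_def quad_form_add_matrix by (smt (verit))
  ultimately show ?thesis by (smt (verit))
qed

lemma closed_loop_schur_stable:
  assumes "admissible P" "ric P = P"
  shows "schur_stable (A - B ** gain P)"
    and "\<exists>C>0. \<forall>x k. norm (((*v) (A - B ** gain P) ^^ k) x) \<le> C * norm x"
proof -
  let ?orbit = "\<lambda>x k. ((*v) (A - B ** gain P) ^^ k) x"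
  obtain e where e: "e > 0" "\<And>x u. lq_cost Q S R x u + quad_form L x - quad_form L (A *v x + B *v u)
      \<ge> e * ((norm x)\<^sup>2 + (norm u)\<^sup>2)"
    using dissipative_with_coercive[OF dissipative] by metis
  note energy = closed_loop_energy[OF assms e(2,1)]
  show "schur_stable (A - B ** gain P)"
  proof (rule tendsto_zero_imp_schur_stable)
    fix x
    have "summable (\<lambda>k. e * (norm (?orbit x k))\<^sup>2)"
      using e(1) energy by (intro summableI_nonneg_bounded) auto
    then have "(\<lambda>k. e * (norm (?orbit x k))\<^sup>2 / e) \<longlonglongrightarrow> 0 / e"
      by (intro tendsto_divide summable_LIMSEQ_zero tendsto_const) (use e(1) in auto)
    then have "(\<lambda>k. sqrt ((norm (?orbit x k))\<^sup>2)) \<longlonglongrightarrow> sqrt 0"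
      using e(1) by (intro tendsto_real_sqrt) simp
    then show "?orbit x \<longlonglongrightarrow> 0"
      by (simp add: tendsto_norm_zero_iff)
  qed
  obtain C where C: "C \<ge> 0" "\<And>x. quad_form (P + L) x \<le> C * (norm x)\<^sup>2"
    using quad_form_upper_bound by blast
  \<comment> \<open>A single term is at most the whole energy sum. The summand 1 keeps the constant
    positive even if \<open>C = 0\<close>.\<close>
  have "norm (?orbit x k) \<le> (sqrt (C / e) + 1) * norm x" for x k
  proof -
    have "e * (norm (?orbit x k))\<^sup>2 \<le> (\<Sum>j<Suc k. e * (norm (?orbit x j))\<^sup>2)"
      using e(1) by (intro member_le_sum) auto
    also have "\<dots> \<le> C * (norm x)\<^sup>2"
      using energy C(2) order_trans by blast
    finally have "(norm (?orbit x k))\<^sup>2 \<le> C / e * (norm x)\<^sup>2"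
      using e(1) by (simp add: field_simps)
    then have "norm (?orbit x k) \<le> sqrt (C / e * (norm x)\<^sup>2)"
      by (rule real_le_rsqrt)
    also have "\<dots> \<le> (sqrt (C / e) + 1) * norm x"
      unfolding real_sqrt_mult real_sqrt_abs abs_norm_cancel by (simp add: distrib_right)
    finally show ?thesis .
  qed
  moreover have "sqrt (C / e) + 1 > 0"
    using C(1) e(1) by (simp add: add_nonneg_pos)
  ultimately show "\<exists>C>0. \<forall>x k. norm (?orbit x k) \<le> C * norm x" by blast
qed

section \<open>Existence and uniqueness of the stabilizing solution\<close>

lemma ex_stabilizing_solution:
  assumes "controllable A B"
  obtains P where "dare_stabilizing_solution A B Q S R P" "admissible P"
proof -
  obtain P where P: "admissible P" "ric P = P"
    using value_iter_limit[OF assms] value_iter_limit_fixpoint by metis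
  then have "dare_stabilizing_solution A B Q S R P"
    using weight_positive_definite[OF P(1)] closed_loop_schur_stable(1)[OF P]
    by (auto simp: dare_stabilizing_solution_def dare_solution_iff admissible_def
        positive_definite_invertible)
  with P(1) show ?thesis by (rule that[rotated])
qed

lemma ex1_stabilizing_solution:
  assumes "controllable A B"
  shows "\<exists>!P. dare_stabilizing_solution A B Q S R P"
  using ex_stabilizing_solution[OF assms] dare_stabilizing_solution_unique[OF Q_sym R_sym]
  by metis

lemma stabilizing_solution_admissible:
  assumes "controllable A B" "dare_stabilizing_solution A B Q S R P"
  shows "admissible P" "ric P = P"
proof -
  show "admissible P"
    using ex_stabilizing_solution[OF assms(1)] dare_stabilizing_solution_unique[OF Q_sym R_sym assms(2)]
    by metis
  show "ric P = P"
    using assms(2) by (simp add: dare_stabilizing_solution_def dare_solution_iff)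
qed

end

subsection \<open>Feedback transformations and time reversal\<close>

text \<open>The pre-stabilized data describe the same problem in the input
  \<open>v = u + K x\<close>; hence controllability, the storage and one-step inequalities carry
  over.\<close>

lemma lq_cost_feedback:
  assumes "symmetric_matrix R"
  shows "lq_cost (Q - transpose S ** K - transpose K ** S + transpose K ** R ** K) (S - R ** K) R x v
    = lq_cost Q S R x (v - K *v x)"
  using symmetric_matrixD[OF assms, of v "K *v x"]
  by (simp add: lq_cost_def quad_form_def bilinear_expand inner_commute)

lemma symmetric_feedback:
  assumes "symmetric_matrix Q" "symmetric_matrix R"
  shows "symmetric_matrix (Q - transpose S ** K - transpose K ** S + transpose K ** R ** K)"
  unfolding symmetric_matrix_iff
proof (intro allI)
  fix x y
  show "x \<bullet> ((Q - transpose S ** K - transpose K ** S + transpose K ** R ** K) *v y)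
      = y \<bullet> ((Q - transpose S ** K - transpose K ** S + transpose K ** R ** K) *v x)"
    using symmetric_matrixD[OF assms(1), of x y] symmetric_matrixD[OF assms(2), of "K *v x" "K *v y"]
    by (simp add: bilinear_expand inner_commute)
qed

lemma controllable_feedback:
  assumes "controllable A B"
  shows "controllable (A - B ** K) B"
  unfolding controllable_def
proof (intro allI)
  fix x0 x1
  obtain N u where u: "trajectory A B x0 u N = x1"
    using assms unfolding controllable_def by blast
  have "trajectory (A - B ** K) B x0 (\<lambda>k. u k + K *v trajectory A B x0 u k) k = trajectory A B x0 u k" for k
    by (induction k) (simp_all add: matrix_vector_expand)
  with u show "\<exists>N u. trajectory (A - B ** K) B x0 u N = x1" by metis
qed

lemma dissipative_with_feedback:
  assumes "symmetric_matrix R" "dissipative_with A B Q S R L"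
  shows "dissipative_with (A - B ** K) B
    (Q - transpose S ** K - transpose K ** S + transpose K ** R ** K) (S - R ** K) R L"
proof -
  have "(A - B ** K) *v x + B *v v = A *v x + B *v (v - K *v x)" for x v
    by (simp add: matrix_vector_expand)
  moreover have "(x, v - K *v x) \<noteq> (0, 0)" if "(x, v) \<noteq> (0, 0)" for x v
    using that by auto
  ultimately show ?thesis
    using assms(2) unfolding dissipative_with_def lq_cost_feedback[OF assms(1)] by metis
qed

section \<open>Time reversal\<close>

definition reverse_Q :: "real^'n^'n \<Rightarrow> real^'n^'n \<Rightarrow> real^'n^'n"
  where "reverse_Q A Q = - (transpose (matrix_inv A) ** Q ** matrix_inv A)"

definition reverse_S :: "real^'n^'n \<Rightarrow> real^'m^'n \<Rightarrow> real^'n^'n \<Rightarrow> real^'n^'m \<Rightarrow> real^'n^'m"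
  where "reverse_S A B Q S = S ** matrix_inv A - transpose (matrix_inv A ** B) ** Q ** matrix_inv A"

definition reverse_R :: "real^'n^'n \<Rightarrow> real^'m^'n \<Rightarrow> real^'n^'n \<Rightarrow> real^'n^'m \<Rightarrow> real^'m^'m \<Rightarrow> real^'m^'m"
  where "reverse_R A B Q S R = - R + S ** (matrix_inv A ** B) + transpose (matrix_inv A ** B) ** transpose S
    - transpose (matrix_inv A ** B) ** Q ** (matrix_inv A ** B)"

lemma rdare_stabilizing_solution_nonsingular_iff:
  "rdare_stabilizing_solution_nonsingular A B Q S R P \<longleftrightarrow>
    dare_stabilizing_solution (matrix_inv A) (matrix_inv A ** B)
      (reverse_Q A Q) (reverse_S A B Q S) (reverse_R A B Q S R) P"
  by (simp add: rdare_stabilizing_solution_nonsingular_def Let_def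
      reverse_Q_def reverse_S_def reverse_R_def)

lemma inner_transpose: "x \<bullet> (transpose M *v y) = (M *v x) \<bullet> (y :: real^'n)"
  by (simp add: inner_vector_matrix)

lemma symmetric_reverse:
  assumes "symmetric_matrix Q" "symmetric_matrix R"
  shows "symmetric_matrix (reverse_Q A Q)" "symmetric_matrix (reverse_R A B Q S R)"
proof -
  show "symmetric_matrix (reverse_Q A Q)"
    using assms by (simp add: reverse_Q_def)
  have "symmetric_matrix (S ** N + transpose N ** transpose S)" for N
    unfolding symmetric_matrix_iff matrix_vector_expand inner_add_right inner_transpose
    by (simp add: inner_commute)
  then have "symmetric_matrix (- R + (S ** N + transpose N ** transpose S) - transpose N ** Q ** N)" for N
    using assms by simp
  then show "symmetric_matrix (reverse_R A B Q S R)"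
    by (simp only: reverse_R_def add.assoc)
qed

text \<open>Running the system backwards in time turns the input \<open>u\<close> into \<open>- u\<close>, and the reversed data
  in the RDARE carry the negated stage cost.\<close>

lemma lq_cost_reverse:
  assumes "symmetric_matrix Q"
  shows "lq_cost (- reverse_Q A Q) (- reverse_S A B Q S) (- reverse_R A B Q S R) z v
    = lq_cost Q S R (matrix_inv A *v z + (matrix_inv A ** B) *v v) (- v)"
proof -
  let ?N = "matrix_inv A ** B"
  have "lq_cost (- reverse_Q A Q) (- reverse_S A B Q S) (- reverse_R A B Q S R) z v
      = (matrix_inv A *v z) \<bullet> (Q *v (matrix_inv A *v z))
        + 2 * ((?N *v v) \<bullet> (Q *v (matrix_inv A *v z)) - v \<bullet> (S *v (matrix_inv A *v z)))
        + v \<bullet> (R *v v) - v \<bullet> (S *v (?N *v v)) - (?N *v v) \<bullet> (transpose S *v v)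
        + (?N *v v) \<bullet> (Q *v (?N *v v))"
    \<comment> \<open>Products are split only at these left factors, so that
      \<open>matrix_inv A ** B\<close> remains one atom.\<close>
    unfolding lq_cost_def quad_form_def reverse_Q_def reverse_S_def reverse_R_def
      matrix_vector_mult_add_rdistrib matrix_vector_mult_diff_rdistrib matrix_vector_mult_minus_left
      matrix_vector_mul_assoc[symmetric, where A = "transpose X" for X]
      matrix_vector_mul_assoc[symmetric, where A = "transpose X ** Y" for X Y]
      matrix_vector_mul_assoc[symmetric, where A = S]
      inner_minus_right inner_add_right inner_diff_right inner_transpose
    by simp
  then show ?thesis
    using symmetric_matrixD[OF assms, of "matrix_inv A *v z" "?N *v v"]
    by (simp add: lq_cost_def quad_form_def bilinear_expand inner_commute)
qed

lemma reverse_step: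
  fixes A :: "real^'n^'n" and B :: "real^'m^'n"
  assumes "invertible A"
  shows "matrix_inv A *v (A *v x + B *v u) + (matrix_inv A ** B) *v (- u) = x"
    and "A *v (matrix_inv A *v z + (matrix_inv A ** B) *v v) + B *v (- v) = z"
  using matrix_inv_cancel[OF assms]
  by (simp_all add: matrix_vector_right_distrib matrix_vector_mul_assoc matrix_mul_assoc)

lemma controllable_reverse:
  assumes "controllable A B" "invertible A"
  shows "controllable (matrix_inv A) (matrix_inv A ** B)"
  unfolding controllable_def
proof (intro allI)
  fix x0 x1
  obtain N u where u: "trajectory A B x1 u N = x0"
    using assms(1) unfolding controllable_def by blast
  \<comment> \<open>Reversed step \<open>k\<close> undoes the forward step from time
    \<open>N - Suc k\<close> to \<open>N - k\<close>.\<close>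
  have "trajectory (matrix_inv A) (matrix_inv A ** B) x0 (\<lambda>k. - u (N - Suc k)) k
      = trajectory A B x1 u (N - k)" if "k \<le> N" for k
    using that
  proof (induction k)
    case 0
    then show ?case by (simp add: u)
  next
    case (Suc k)
    then have "N - k = Suc (N - Suc k)" by simp
    then have "trajectory A B x1 u (N - k)
        = A *v trajectory A B x1 u (N - Suc k) + B *v u (N - Suc k)"
      by (simp only: trajectory.simps)
    with Suc show ?case
      by (simp only: trajectory.simps Suc_leD reverse_step(1)[OF assms(2)])
  qed
  from this[of N] show "\<exists>N u. trajectory (matrix_inv A) (matrix_inv A ** B) x0 u N = x1"
    by (auto intro!: exI)
qed

text \<open>Reversal exchanges the two ends of a step, so negating the storage reproduces the same
  rotated cost.\<close>

lemma dissipative_with_reverse: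
  fixes A :: "real^'n^'n" and B :: "real^'m^'n"
  assumes "symmetric_matrix Q" "invertible A" "dissipative_with A B Q S R L"
  shows "dissipative_with (matrix_inv A) (matrix_inv A ** B)
    (- reverse_Q A Q) (- reverse_S A B Q S) (- reverse_R A B Q S R) (- L)"
  unfolding dissipative_with_def lq_cost_reverse[OF assms(1)]
proof (intro conjI allI impI)
  show "symmetric_matrix (- L)" using assms(3) by (simp add: dissipative_with_def)
  fix z :: "real^'n" and v :: "real^'m"
  assume zv: "(z, v) \<noteq> (0, 0)"
  define x where "x = matrix_inv A *v z + (matrix_inv A ** B) *v v"
  have z: "A *v x + B *v (- v) = z"
    unfolding x_def by (rule reverse_step(2)[OF assms(2)])
  with zv have "(x, - v) \<noteq> (0, 0)" by auto
  with assms(3) have "0 < lq_cost Q S R x (- v) + quad_form L x - quad_form L (A *v x + B *v (- v))"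
    unfolding dissipative_with_def by blast
  then show "0 < lq_cost Q S R (matrix_inv A *v z + (matrix_inv A ** B) *v v) (- v) + quad_form (- L) z
      - quad_form (- L) (matrix_inv A *v z + (matrix_inv A ** B) *v v)"
    unfolding z x_def[symmetric] by simp
qed

text \<open>The Bellman inequality of \<open>- P\<close> for the reversed system, taken at the state
  \<open>A x + B u\<close> with input \<open>- u\<close>, leads back to \<open>x\<close>;
  rearranged, it is a one-step inequality in forward time.\<close>

lemma rdare_nonsingular:
  assumes "symmetric_matrix Q" "symmetric_matrix R" "dissipative_with A B Q S R L"
    and "controllable A B" "invertible A"
  shows "\<exists>!P. rdare_stabilizing_solution_nonsingular A B Q S R P"
    and "rdare_stabilizing_solution_nonsingular A B Q S R P \<Longrightarrow>
      quad_form P x \<le> lq_cost Q S R x u + quad_form P (A *v x + B *v u)"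
proof -
  interpret rev: dissipative_lq "matrix_inv A" "matrix_inv A ** B"
    "- reverse_Q A Q" "- reverse_S A B Q S" "- reverse_R A B Q S R" "- L"
    by unfold_locales (simp_all add: assms symmetric_reverse[OF assms(1,2)] dissipative_with_reverse)
  note ctrl = controllable_reverse[OF assms(4,5)]
  have iff: "rdare_stabilizing_solution_nonsingular A B Q S R P \<longleftrightarrow>
      dare_stabilizing_solution (matrix_inv A) (matrix_inv A ** B)
        (- reverse_Q A Q) (- reverse_S A B Q S) (- reverse_R A B Q S R) (- P)" for P
    unfolding rdare_stabilizing_solution_nonsingular_iff
    using dare_stabilizing_solution_minus[of "matrix_inv A" "matrix_inv A ** B"
        "- reverse_Q A Q" "- reverse_S A B Q S" "- reverse_R A B Q S R" "- P"]
    by (auto intro: dare_stabilizing_solution_minus)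
  show "\<exists>!P. rdare_stabilizing_solution_nonsingular A B Q S R P"
    unfolding iff using rev.ex1_stabilizing_solution[OF ctrl] by (metis minus_minus)
  assume "rdare_stabilizing_solution_nonsingular A B Q S R P"
  note P = rev.stabilizing_solution_admissible[OF ctrl this[unfolded iff]]
  show "quad_form P x \<le> lq_cost Q S R x u + quad_form P (A *v x + B *v u)"
    using rev.ric_le[OF P(1), of "A *v x + B *v u" "- u"]
    unfolding P(2) lq_cost_reverse[OF assms(1)] reverse_step(1)[OF assms(5)] by simp
qed

lemma rdare_properties:
  assumes "symmetric_matrix Q" "symmetric_matrix R" "dissipative_with A B Q S R L"
    and "controllable A B" "invertible (A - B ** K)"
  shows "\<exists>!P. rdare_stabilizing_solution A B Q S R K P"
    and "rdare_stabilizing_solution A B Q S R K P \<Longrightarrow>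
      quad_form P x \<le> lq_cost Q S R x u + quad_form P (A *v x + B *v u)"
proof -
  note feedback = symmetric_feedback[OF assms(1,2)] assms(2)
    dissipative_with_feedback[OF assms(2,3)] controllable_feedback[OF assms(4)] assms(5)
  show "\<exists>!P. rdare_stabilizing_solution A B Q S R K P"
    unfolding rdare_stabilizing_solution_def by (rule rdare_nonsingular(1)[OF feedback])
  assume "rdare_stabilizing_solution A B Q S R K P"
  from rdare_nonsingular(2)[OF feedback this[unfolded rdare_stabilizing_solution_def], of x "u + K *v x"]
  show "quad_form P x \<le> lq_cost Q S R x u + quad_form P (A *v x + B *v u)"
    unfolding lq_cost_feedback[OF assms(2)] by (simp add: matrix_vector_expand)
qed

text \<open>A kernel vector \<open>v\<close> of \<open>A - B K\<close> is removed by the rank-one change \<open>x \<mapsto> (v \<bullet> x) c\<close> of \<open>K\<close>,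
  where \<open>B c\<close> lies outside the range of \<open>A - B K\<close>; the kernel does not gain any vectors.\<close>

lemma ex_invertible_feedback:
  fixes A :: "real^'n^'n" and B :: "real^'m^'n"
  assumes "controllable A B"
  shows "\<exists>K. invertible (A - B ** K)"
proof -
  define ker where "ker K = {x. (A - B ** K) *v x = 0}" for K
  have subspace_ker: "subspace (ker K)" for K
    by (simp add: ker_def subspace_def matrix_vector_right_distrib matrix_vector_mult_scaleR)
  \<comment> \<open>Extremal choice: a singular \<open>A - B K\<close> would admit a strictly
    smaller kernel.\<close>
  obtain K where K: "\<And>K'. dim (ker K) \<le> dim (ker K')"
    using ex_has_least_nat[of "\<lambda>_. True" _ "\<lambda>K. dim (ker K)"] by auto
  let ?M = "A - B ** K"
  have "invertible ?M"
  proof (rule ccontr)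
    assume sing: "\<not> invertible ?M"
    then obtain v where v: "v \<noteq> 0" "?M *v v = 0"
      by (auto simp: invertible_left_inverse matrix_left_invertible_ker)
    have "\<not> invertible (transpose ?M)"
      using sing transpose_invertible[of "transpose ?M"] by auto
    then obtain w where w: "w \<noteq> 0" "transpose ?M *v w = 0"
      by (auto simp: invertible_left_inverse matrix_left_invertible_ker)
    have wM: "w \<bullet> (?M *v x) = 0" for x
      using w(2) by (metis dot_lmul_matrix inner_zero_left transpose_matrix_vector)
    \<comment> \<open>Otherwise \<open>w\<close> is orthogonal to the ranges of \<open>A\<close> and
      \<open>B\<close>, so no trajectory from the origin reaches \<open>w\<close>.\<close>
    have "\<exists>c. w \<bullet> (B *v c) \<noteq> 0"
    proof (rule ccontr)
      assume "\<nexists>c. w \<bullet> (B *v c) \<noteq> 0"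
      then have wB: "w \<bullet> (B *v c) = 0" for c by blast
      have wA: "w \<bullet> (A *v x) = 0" for x
        using wM[of x] wB[of "K *v x"] by (simp add: matrix_vector_expand inner_diff_right)
      obtain N u where u: "trajectory A B 0 u N = w"
        using assms unfolding controllable_def by blast
      have "w \<bullet> trajectory A B 0 u N = 0"
        by (cases N) (simp_all add: inner_add_right wA wB)
      with u w(1) show False by simp
    qed
    then obtain c where c: "w \<bullet> (B *v c) \<noteq> 0" by blast
    define K' where "K' = K + (\<chi> i j. c $ i * v $ j)"
    have "(\<chi> i j. c $ i * v $ j) *v x = (v \<bullet> x) *\<^sub>R c" for x
      by (simp add: vec_eq_iff matrix_vector_mult_def inner_vec_def sum_distrib_left
          sum_distrib_right mult_ac)
    then have K': "(A - B ** K') *v x = ?M *v x - (v \<bullet> x) *\<^sub>R (B *v c)" for x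
      by (simp add: K'_def matrix_vector_expand matrix_vector_mult_scaleR)
    have "ker K' \<subseteq> ker K"
    proof
      fix x assume "x \<in> ker K'"
      then have x: "?M *v x = (v \<bullet> x) *\<^sub>R (B *v c)" by (simp add: ker_def K')
      then have "(v \<bullet> x) * (w \<bullet> (B *v c)) = 0" using wM[of x] by simp
      with c x show "x \<in> ker K" by (simp add: ker_def)
    qed
    moreover have "v \<in> ker K" using v by (simp add: ker_def)
    moreover have "v \<notin> ker K'"
      using c v by (auto simp: ker_def K')
    ultimately have "ker K' \<subset> ker K" by blast
    then have "dim (ker K') < dim (ker K)"
      by (intro dim_psubset) (simp add: span_eq_iff[THEN iffD2, OF subspace_ker])
    with K[of K'] show False by simp
  qed
  then show ?thesis by blast
qed

lemma ex_pre_stabilizing_gain: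
  assumes "controllable A B"
  shows "\<exists>K. pre_stabilizing_gain A B K"
  using ex_invertible_feedback[OF assms] by (auto simp: pre_stabilizing_gain_def)

lemma pre_stabilizing_gainD:
  assumes "pre_stabilizing_gain A B K"
  shows "invertible (A - B ** K)"
proof -
  have "A - B ** 0 = A"
    by (simp add: matrix_eq matrix_vector_expand)
  with assms show ?thesis
    by (auto simp: pre_stabilizing_gain_def split: if_splits)
qed

subsection \<open>The infinite-horizon problem\<close>

context dissipative_lq
begin

abbreviation "horizon_cost Pf x u N \<equiv> finite_horizon_cost A B (cost_matrix Q S R) Pf x u N"

lemma finite_horizon_cost_eq:
  "horizon_cost Pf x u N = (\<Sum>k<N. lq_cost Q S R (trajectory A B x u k) (u k))
    + quad_form Pf (trajectory A B x u N)"
  by (simp add: finite_horizon_cost_def stage_cost_cost_matrix quad_form_def)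

lemma horizon_cost_complete_square:
  assumes "admissible P" "ric P = P"
  shows "horizon_cost Pf x u N = quad_form P x
    + (\<Sum>k<N. quad_form (weight P) (u k + gain P *v trajectory A B x u k))
    + quad_form (Pf - P) (trajectory A B x u N)"
proof -
  have "(\<Sum>k<N. lq_cost Q S R (trajectory A B x u k) (u k)) + quad_form P (trajectory A B x u N)
      = quad_form P x + (\<Sum>k<N. quad_form (weight P) (u k + gain P *v trajectory A B x u k))"
  proof (induction N)
    case (Suc N)
    with complete_square[OF assms(1), of "trajectory A B x u N" "u N"] show ?case
      unfolding assms(2) by simp
  qed simp
  then show ?thesis by (simp add: finite_horizon_cost_eq quad_form_diff_matrix)
qed

lemma trajectory_tendsto_zero:
  assumes Pb: "\<And>x u. quad_form Pb x \<le> lq_cost Q S R x u + quad_form Pb (A *v x + B *v u)"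
    and E: "positive_definite E"
    and J: "lqr_has_cost A B (cost_matrix Q S R) (Pb + E) x u J" "J \<noteq> \<infinity>"
  shows "trajectory A B x u \<longlonglongrightarrow> 0"
proof -
  let ?x = "trajectory A B x u"
  have lower: "quad_form Pb x + quad_form E (?x N) \<le> horizon_cost (Pb + E) x u N" for N
  proof -
    have "quad_form Pb x \<le> (\<Sum>k<N. lq_cost Q S R (?x k) (u k)) + quad_form Pb (?x N)"
    proof (induction N)
      case (Suc N)
      with Pb[of "?x N" "u N"] show ?case by simp
    qed simp
    then show ?thesis by (simp add: finite_horizon_cost_eq quad_form_add_matrix)
  qed
  \<comment> \<open>\<open>J\<close> may still be \<open>-\<infinity>\<close> here, so
    \<open>C\<close> is any real above it, and it bounds the costs only from some \<open>N0\<close>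
    on.\<close>
  obtain C where "J < ereal C"
    using J(2) by (metis ereal_dense2 ereal_infty_less(1))
  with J(1) have "eventually (\<lambda>N. ereal (horizon_cost (Pb + E) x u N) < ereal C) sequentially"
    unfolding lqr_has_cost_def by (rule order_tendstoD(2))
  then obtain N0 where N0: "\<And>N. N \<ge> N0 \<Longrightarrow> horizon_cost (Pb + E) x u N \<le> C"
    by (auto simp: eventually_sequentially intro: less_imp_le)
  obtain d where d: "d > 0" "\<And>y. quad_form E y \<ge> d * (norm y)\<^sup>2"
    using quad_form_coercive[OF E] by blast
  obtain D where D: "D \<ge> 0" "\<And>y. quad_form (- (Pb + E + L)) y \<le> D * (norm y)\<^sup>2"
    using quad_form_upper_bound by blast
  obtain e where e: "e > 0" "\<And>x u. lq_cost Q S R x u + quad_form L x - quad_form L (A *v x + B *v u)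
      \<ge> e * ((norm x)\<^sup>2 + (norm u)\<^sup>2)"
    using dissipative_with_coercive[OF dissipative] by metis
  \<comment> \<open>The energy sum is at most the cost plus \<open>L\<close> at \<open>x\<close>
    minus \<open>Pb + E + L\<close> at the end state. The last part is controlled by
    \<open>D\<close> and the bound \<open>(C - quad_form Pb x) / d\<close> on the squared norm of
    that state.\<close>
  define bound where "bound = C + quad_form L x + D * ((C - quad_form Pb x) / d)"
  have energy: "(\<Sum>k<N. e * (norm (?x k))\<^sup>2)
      \<le> (\<Sum>k<N. lq_cost Q S R (?x k) (u k)) + quad_form L x - quad_form L (?x N)" for N
  proof (induction N)
    case (Suc N)
    have "e * (norm (?x N))\<^sup>2 \<le> e * ((norm (?x N))\<^sup>2 + (norm (u N))\<^sup>2)"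
      using e(1) by simp
    with Suc e(2)[of "?x N" "u N"] show ?case by simp
  qed simp
  have "(\<Sum>k<N. e * (norm (?x k))\<^sup>2) \<le> bound" for N
  proof -
    \<comment> \<open>The cost bound holds only from \<open>N0\<close> on; earlier partial sums are
      smaller because the summands are nonnegative.\<close>
    define n where "n = max N N0"
    have "(norm (?x n))\<^sup>2 \<le> (C - quad_form Pb x) / d"
      using d(1) d(2)[of "?x n"] lower[of n] N0[of n] by (simp add: n_def field_simps)
    then have "quad_form (- (Pb + E + L)) (?x n) \<le> D * ((C - quad_form Pb x) / d)"
      using D(2)[of "?x n"] mult_left_mono[OF _ D(1)] order_trans by blast
    then have "(\<Sum>k<n. e * (norm (?x k))\<^sup>2) \<le> bound"
      using energy[of n] N0[of n]
      by (simp add: bound_def finite_horizon_cost_eq quad_form_add_matrix quad_form_diff_matrix n_def)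
    moreover have "(\<Sum>k<N. e * (norm (?x k))\<^sup>2) \<le> (\<Sum>k<n. e * (norm (?x k))\<^sup>2)"
      using e(1) by (intro sum_mono2) (auto simp: n_def)
    ultimately show ?thesis by linarith
  qed
  then have "summable (\<lambda>k. e * (norm (?x k))\<^sup>2)"
    using e(1) by (intro summableI_nonneg_bounded) auto
  then have "(\<lambda>k. e * (norm (?x k))\<^sup>2 / e) \<longlonglongrightarrow> 0 / e"
    by (intro tendsto_divide summable_LIMSEQ_zero tendsto_const) (use e(1) in auto)
  then have "(\<lambda>k. sqrt ((norm (?x k))\<^sup>2)) \<longlonglongrightarrow> sqrt 0"
    using e(1) by (intro tendsto_real_sqrt) simp
  then show ?thesis by (simp add: tendsto_norm_zero_iff)
qed

text \<open>One square is kept instead of discarding all: if \<open>J\<close> equals the value of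
  \<open>P\<close>, it must vanish, which makes the optimal input unique.\<close>

lemma cost_lower_bound:
  assumes P: "admissible P" "ric P = P"
    and cost: "lqr_has_cost A B (cost_matrix Q S R) Pf x u J"
    and lim: "trajectory A B x u \<longlonglongrightarrow> 0"
  shows "ereal (quad_form P x + quad_form (weight P) (u k + gain P *v trajectory A B x u k)) \<le> J"
proof (rule LIMSEQ_le)
  let ?sq = "\<lambda>k. quad_form (weight P) (u k + gain P *v trajectory A B x u k)"
  show "(\<lambda>N. ereal (horizon_cost Pf x u N)) \<longlonglongrightarrow> J"
    using cost by (simp add: lqr_has_cost_def)
  have "(\<lambda>N. quad_form P x + ?sq k + quad_form (Pf - P) (trajectory A B x u N))
      \<longlonglongrightarrow> quad_form P x + ?sq k + quad_form (Pf - P) 0"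
    by (intro tendsto_intros tendsto_quad_form lim)
  then show "(\<lambda>N. ereal (quad_form P x + ?sq k + quad_form (Pf - P) (trajectory A B x u N)))
      \<longlonglongrightarrow> ereal (quad_form P x + ?sq k)"
    by simp
  have nonneg: "?sq j \<ge> 0" for j
    using weight_positive_definite[OF P(1)] unfolding positive_definite_iff
    by (metis less_eq_real_def quad_form_zero)
  have "?sq k \<le> (\<Sum>j<N. ?sq j)" if "N \<ge> Suc k" for N
    using that by (intro member_le_sum) (auto simp: nonneg)
  then show "\<exists>n. \<forall>N\<ge>n. ereal (quad_form P x + ?sq k + quad_form (Pf - P) (trajectory A B x u N))
      \<le> ereal (horizon_cost Pf x u N)"
    unfolding horizon_cost_complete_square[OF P] by (intro exI[of _ "Suc k"]) auto
qed

section \<open>The optimal feedback\<close>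

lemma trajectory_feedback:
  assumes "\<And>k. u k = - (K *v trajectory A B x u k)"
  shows "trajectory A B x u k = ((*v) (A - B ** K) ^^ k) x"
proof (induction k)
  case (Suc k)
  have "trajectory A B x u (Suc k) = (A - B ** K) *v trajectory A B x u k"
    using assms[of k] by (simp add: matrix_vector_expand)
  with Suc show ?case by simp
qed simp

lemma feedback_has_cost:
  assumes P: "admissible P" "ric P = P" and u: "\<And>k. u k = - (gain P *v trajectory A B x u k)"
  shows "lqr_has_cost A B (cost_matrix Q S R) Pf x u (ereal (quad_form P x))"
proof -
  have "trajectory A B x u = (\<lambda>k. ((*v) (A - B ** gain P) ^^ k) x)"
    using trajectory_feedback[OF u] by blast
  then have lim: "trajectory A B x u \<longlonglongrightarrow> 0"
    using schur_stable_imp_tendsto_zero[OF closed_loop_schur_stable(1)[OF P]] by simp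
  have "u k + gain P *v trajectory A B x u k = 0" for k
    using u[of k] by simp
  then have "horizon_cost Pf x u N = quad_form P x + quad_form (Pf - P) (trajectory A B x u N)" for N
    unfolding horizon_cost_complete_square[OF P] by simp
  moreover have "(\<lambda>N. quad_form P x + quad_form (Pf - P) (trajectory A B x u N))
      \<longlonglongrightarrow> quad_form P x + quad_form (Pf - P) 0"
    by (intro tendsto_intros tendsto_quad_form lim)
  ultimately show ?thesis by (simp add: lqr_has_cost_def)
qed

text \<open>The equation is implicit, as the trajectory depends on \<open>u\<close>; the witness is
  read off the closed-loop orbit.\<close>

lemma ex_feedback_input: "\<exists>u. \<forall>k. u k = - (K *v trajectory A B x u k)"
proof -
  define u where "u k = - (K *v (((*v) (A - B ** K) ^^ k) x))" for k
  have "(A - B ** K) *v y = A *v y + B *v (- (K *v y))" for y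
    by (simp add: matrix_vector_expand)
  then have "trajectory A B x u k = ((*v) (A - B ** K) ^^ k) x" for k
    by (induction k) (simp_all only: trajectory.simps funpow.simps id_apply o_apply u_def)
  then show ?thesis by (intro exI[of _ u]) (simp add: u_def)
qed

text \<open>\<open>Pb\<close> enters through its one-step inequality, which forces inputs of cost
  below \<open>\<infinity>\<close> to steer the state to the origin; the value then comes from
  \<open>P\<close>.\<close>

theorem optimal_feedback:
  assumes P: "admissible P" "ric P = P"
    and Pb: "\<And>x u. quad_form Pb x \<le> lq_cost Q S R x u + quad_form Pb (A *v x + B *v u)"
    and E: "positive_definite E"
  shows "lqr_value A B (cost_matrix Q S R) (Pb + E) x = ereal (quad_form P x)"
    and "lqr_optimal_input A B (cost_matrix Q S R) (Pb + E) x u \<longleftrightarrow>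
      (\<forall>k. u k = - (gain P *v trajectory A B x u k))"
proof -
  let ?cost = "lqr_has_cost A B (cost_matrix Q S R) (Pb + E) x"
  have bound: "ereal (quad_form P x + quad_form (weight P) (u k + gain P *v trajectory A B x u k)) \<le> J"
    if "?cost u J" for u J k
  proof (cases "J = \<infinity>")
    case False
    show ?thesis
      by (rule cost_lower_bound[OF P that trajectory_tendsto_zero[OF Pb E that False]])
  qed simp
  have pd: "positive_definite (weight P)" by (rule weight_positive_definite[OF P(1)])
  have "ereal (quad_form P x) \<le> J" if "?cost u J" for u J
  proof -
    have "0 \<le> quad_form (weight P) (u 0 + gain P *v trajectory A B x u 0)"
      using pd unfolding positive_definite_iff by (metis less_eq_real_def quad_form_zero)
    then have "ereal (quad_form P x)
        \<le> ereal (quad_form P x + quad_form (weight P) (u 0 + gain P *v trajectory A B x u 0))"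
      by simp
    also have "\<dots> \<le> J" by (rule bound[OF that])
    finally show ?thesis .
  qed
  moreover obtain u' where "\<forall>k. u' k = - (gain P *v trajectory A B x u' k)"
    using ex_feedback_input by blast
  then have "?cost u' (ereal (quad_form P x))"
    by (intro feedback_has_cost P) simp
  ultimately show val: "lqr_value A B (cost_matrix Q S R) (Pb + E) x = ereal (quad_form P x)"
    unfolding lqr_value_def by (intro antisym Inf_lower Inf_greatest) auto
  show "lqr_optimal_input A B (cost_matrix Q S R) (Pb + E) x u \<longleftrightarrow>
      (\<forall>k. u k = - (gain P *v trajectory A B x u k))"
  proof
    assume "lqr_optimal_input A B (cost_matrix Q S R) (Pb + E) x u"
    then have opt: "?cost u (ereal (quad_form P x))"
      by (simp add: lqr_optimal_input_def val)
    have "u k + gain P *v trajectory A B x u k = 0" for k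
    proof (rule ccontr)
      assume "u k + gain P *v trajectory A B x u k \<noteq> 0"
      with pd have "0 < quad_form (weight P) (u k + gain P *v trajectory A B x u k)"
        by (simp add: positive_definite_iff)
      with bound[OF opt, of k] show False by simp
    qed
    then show "\<forall>k. u k = - (gain P *v trajectory A B x u k)"
      by (simp add: eq_neg_iff_add_eq_0)
  next
    assume "\<forall>k. u k = - (gain P *v trajectory A B x u k)"
    then show "lqr_optimal_input A B (cost_matrix Q S R) (Pb + E) x u"
      unfolding lqr_optimal_input_def val by (intro feedback_has_cost P) simp
  qed
qed

lemma closed_loop_asymptotically_stable:
  assumes P: "admissible P" "ric P = P"
  shows "asymptotically_stable_equilibrium (\<lambda>x. A *v x + B *v (- (gain P *v x))) 0"
proof -
  have f: "(\<lambda>x. A *v x + B *v (- (gain P *v x))) = (*v) (A - B ** gain P)"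
    by (simp add: fun_eq_iff matrix_vector_expand)
  obtain C where C: "C > 0" "\<And>x k. norm (((*v) (A - B ** gain P) ^^ k) x) \<le> C * norm x"
    using closed_loop_schur_stable(2)[OF P] by blast
  show ?thesis
    unfolding asymptotically_stable_equilibrium_def f
  proof (intro conjI allI impI)
    show "(A - B ** gain P) *v 0 = 0" by simp
    fix \<epsilon> :: real assume "\<epsilon> > 0"
    have "norm (((*v) (A - B ** gain P) ^^ k) x) < \<epsilon>" if "norm x < \<epsilon> / C" for x k
      using C(2)[of k x] that C(1) by (simp add: field_simps)
    then show "\<exists>\<delta>>0. \<forall>x0. dist x0 0 < \<delta> \<longrightarrow> (\<forall>k. dist (((*v) (A - B ** gain P) ^^ k) x0) 0 < \<epsilon>)"
      using \<open>\<epsilon> > 0\<close> C(1) by (intro exI[of _ "\<epsilon> / C"]) simp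
  next
    show "\<exists>\<delta>>0. \<forall>x0. dist x0 0 < \<delta> \<longrightarrow> (\<lambda>k. ((*v) (A - B ** gain P) ^^ k) x0) \<longlonglongrightarrow> 0"
      using schur_stable_imp_tendsto_zero[OF closed_loop_schur_stable(1)[OF P]]
      by (intro exI[of _ 1]) simp
  qed
qed

end

text \<open>\<open>Khat\<close> ranges over all allowed choices, so for singular \<open>A\<close>
  every pre-stabilization is covered; existence is asserted first so that the claim is not
  vacuous.\<close>

theorem mainTheorem2:
  fixes A :: "real^'nx^'nx" and B :: "real^'nu^'nx"
    and Q :: "real^'nx^'nx" and S :: "real^'nx^'nu" and R :: "real^'nu^'nu"
  assumes "symmetric_matrix (cost_matrix Q S R)"
    and "quadratic_strict_xu_pre_dissipative A B Q S R"
    and "controllable A B"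
  shows "(\<exists>Khat. pre_stabilizing_gain A B Khat) \<and>
    (\<forall>Khat. pre_stabilizing_gain A B Khat \<longrightarrow>
      (\<exists>!Pbar. rdare_stabilizing_solution A B Q S R Khat Pbar) \<and>
      (\<forall>Pbar E. rdare_stabilizing_solution A B Q S R Khat Pbar \<and>
          symmetric_matrix E \<and> positive_definite E \<longrightarrow>
        (\<exists>!Ps. dare_stabilizing_solution A B Q S R Ps) \<and>
        (\<forall>Ps. dare_stabilizing_solution A B Q S R Ps \<longrightarrow>
          (let H = cost_matrix Q S R; Pf = Pbar + E; Ks = dare_gain A B S R Ps in
            (\<forall>x. lqr_value A B H Pf x = ereal (x \<bullet> (Ps *v x)) \<and>
              (\<exists>u. lqr_optimal_input A B H Pf x u) \<and>
              (\<forall>u. lqr_optimal_input A B H Pf x u \<longleftrightarrow>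
                (\<forall>k. u k = - (Ks *v trajectory A B x u k)))) \<and>
            asymptotically_stable_equilibrium
              (\<lambda>x. A *v x + B *v (- (Ks *v x))) 0))))"
proof -
  note sym = symmetric_cost_matrixD[OF assms(1)]
  obtain L where L: "dissipative_with A B Q S R L"
    using pre_dissipative_imp_dissipative_with[OF assms(2)] .
  interpret dissipative_lq A B Q S R L
    by unfold_locales (fact sym L)+
  show ?thesis
    unfolding Let_def
  proof (intro conjI allI impI)
    show "\<exists>Khat. pre_stabilizing_gain A B Khat"
      by (rule ex_pre_stabilizing_gain[OF assms(3)])
  next
    fix Khat assume "pre_stabilizing_gain A B Khat"
    then show "\<exists>!Pbar. rdare_stabilizing_solution A B Q S R Khat Pbar"
      by (intro rdare_properties(1)[OF sym L assms(3)] pre_stabilizing_gainD)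
  next
    show "\<exists>!Ps. dare_stabilizing_solution A B Q S R Ps"
      by (rule ex1_stabilizing_solution[OF assms(3)])
  next
    fix Khat Pbar Ps x and E :: "real^'nx^'nx"
    assume Khat: "pre_stabilizing_gain A B Khat"
      and Pbar: "rdare_stabilizing_solution A B Q S R Khat Pbar \<and> symmetric_matrix E \<and> positive_definite E"
      and "dare_stabilizing_solution A B Q S R Ps"
    note Ps = stabilizing_solution_admissible[OF assms(3) this(3)]
    have Pbar_le: "quad_form Pbar y \<le> lq_cost Q S R y v + quad_form Pbar (A *v y + B *v v)" for y v
      using Pbar by (intro rdare_properties(2)[OF sym L assms(3) pre_stabilizing_gainD[OF Khat]]) blast
    have E: "positive_definite E" using Pbar by blast
    note optimal = optimal_feedback[OF Ps Pbar_le E]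
    show "lqr_value A B (cost_matrix Q S R) (Pbar + E) x = ereal (x \<bullet> (Ps *v x))"
      using optimal(1) by (simp add: quad_form_def)
    show "\<exists>u. lqr_optimal_input A B (cost_matrix Q S R) (Pbar + E) x u"
      unfolding optimal(2) by (rule ex_feedback_input)
    show "lqr_optimal_input A B (cost_matrix Q S R) (Pbar + E) x u \<longleftrightarrow>
        (\<forall>k. u k = - (gain Ps *v trajectory A B x u k))" for u
      by (rule optimal(2))
  next
    fix Khat Pbar E Ps
    assume "dare_stabilizing_solution A B Q S R Ps"
    then show "asymptotically_stable_equilibrium (\<lambda>x. A *v x + B *v (- (gain Ps *v x))) 0"
      by (intro closed_loop_asymptotically_stable stabilizing_solution_admissible assms(3))
  qed
qed

end
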